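(* Let $N\ge1$, $\alpha\in\mathbb{C}$ with $(q^{1-\alpha};q)_\infty\neq0$, and let $u_0,\ldots,u_N,z\in\mathbb{C}$ with $u_0,\ldots,u_N,\ z-u_0,\ z+u_1\notin\Lambda_\tau$. Put $u=u_0+\cdots+u_N$. Then $$\hat\mu_N(u_0,\ldots,u_N;\alpha;\tau)-\hat\mu_N(u_0-z,u_1+z,u_2,\ldots,u_N;\alpha;\tau)$$ $$=\frac{e^{\pi i(\alpha-1)u+\pi i\alpha\tau}\vartheta(\alpha\tau)\vartheta(z)\vartheta(z-u_0+u_1)(q;q)_\infty}{\vartheta(z-u_0)\vartheta(z+u_1)\vartheta(u_0)\cdots\vartheta(u_N)(q^{1-\alpha};q)_\infty}\sum_{n\in\mathbb{Z}^{N-1}}q^{\frac12{}^t n\widehat S n}\prod_{j=1}^{N-1}e^{2\pi in_j(u_0+u_1-u_{j+1})}\;{}_1\phi_1\!\left(q^{1-\alpha};0;q;e^{2\pi i(u_0+u_1+\alpha\tau)}q^{|n|}\right),$$ where for $N=1$ the sum over $\mathbb{Z}^0$ consists of the single term $n=()$ with $|n|=0$.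
   Context: Fix $\tau$ with $\operatorname{Im}\tau>0$, $q=e^{2\pi i\tau}$, $\Lambda_\tau=\mathbb{Z}+\tau\mathbb{Z}$, $q^\beta:=e^{2\pi i\beta\tau}$. $(x;q)_\infty=\prod_{j\ge0}(1-xq^j)$, $(x;q)_n=\prod_{j=0}^{n-1}(1-xq^j)$. $\vartheta(u)=\vartheta(u;\tau)=-ie^{-\pi iu}q^{1/8}(q;q)_\infty(e^{2\pi iu};q)_\infty(qe^{-2\pi iu};q)_\infty$. For $n\in\mathbb{Z}^k$, $|n|$ is the sum of its entries. $\widehat S$ is the $(N-1)\times(N-1)$ matrix with entries $1+\delta_{jk}$ (2 on the diagonal, 1 elsewhere). ${}_1\phi_1(b;0;q;x)=\sum_{n\ge0}\frac{(b;q)_n}{(q;q)_n}(-1)^nq^{n(n-1)/2}x^n$. The multivariable generalized $\mu$-function is $$\hat\mu_N(u_0,\ldots,u_N;\alpha;\tau)=e^{\pi i(\alpha-1)u}\sum_{n\in\mathbb{Z}^N}\frac{e^{\pi iu_0}\,(e^{2\pi iu_0}q^{\alpha+|n|};q)_\infty}{(e^{2\pi iu_0}q^{|n|};q)_\infty}\prod_{j=1}^N\frac{(-1)^{n_j}e^{-2\pi in_ju_j}q^{n_j(n_j+1)/2}}{\vartheta(u_j;\tau)},\quad u=u_0+\cdots+u_N.$$ *)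

theory Defs
  imports "HOL-Analysis.Analysis"
begin

definition nome :: "complex \<Rightarrow> complex" where
  "nome \<tau> = exp (2 * pi * \<i> * \<tau>)"

definition qpow :: "complex \<Rightarrow> complex \<Rightarrow> complex" where
  "qpow \<tau> \<beta> = exp (2 * pi * \<i> * \<beta> * \<tau>)"

definition qpoch :: "complex \<Rightarrow> complex \<Rightarrow> nat \<Rightarrow> complex" where
  "qpoch x q n = (\<Prod>j<n. 1 - x * q ^ j)"

definition qpoch_inf :: "complex \<Rightarrow> complex \<Rightarrow> complex" where
  "qpoch_inf x q = lim (\<lambda>n. qpoch x q n)"

definition jtheta :: "complex \<Rightarrow> complex \<Rightarrow> complex" where
  "jtheta u \<tau> = - \<i> * exp (- pi * \<i> * u) * qpow \<tau> (1/8) * qpoch_inf (nome \<tau>) (nome \<tau>)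
     * qpoch_inf (exp (2 * pi * \<i> * u)) (nome \<tau>)
     * qpoch_inf (nome \<tau> * exp (- 2 * pi * \<i> * u)) (nome \<tau>)"

definition lattice :: "complex \<Rightarrow> complex set" where
  "lattice \<tau> = {of_int m + of_int n * \<tau> | m n. True}"

definition phi11 :: "complex \<Rightarrow> complex \<Rightarrow> complex \<Rightarrow> complex" where
  "phi11 b q x = (\<Sum>n. qpoch b q n / qpoch q q n * (-1) ^ n * q ^ (n * (n - 1) div 2) * x ^ n)"

text \<open>Multivariable generalized mu-function; u 0, ..., u N are the arguments u_0..u_N,
  an element of Z^N is an integer list of length N (entry j is n_{j+1}).\<close>
definition mu_hat :: "nat \<Rightarrow> (nat \<Rightarrow> complex) \<Rightarrow> complex \<Rightarrow> complex \<Rightarrow> complex" where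
  "mu_hat N u \<alpha> \<tau> =
     exp (pi * \<i> * (\<alpha> - 1) * (\<Sum>j\<le>N. u j)) *
     (\<Sum>\<^sub>\<infinity> ns \<in> {ns :: int list. length ns = N}.
        exp (pi * \<i> * u 0)
        * qpoch_inf (exp (2 * pi * \<i> * u 0) * qpow \<tau> (\<alpha> + of_int (sum_list ns))) (nome \<tau>)
        / qpoch_inf (exp (2 * pi * \<i> * u 0) * qpow \<tau> (of_int (sum_list ns))) (nome \<tau>)
        * (\<Prod>j<N. (-1) powi (ns ! j) * exp (- 2 * pi * \<i> * of_int (ns ! j) * u (Suc j))
             * qpow \<tau> (of_int (ns ! j) * (of_int (ns ! j) + 1) / 2)
             / jtheta (u (Suc j)) \<tau>))"

text \<open>The matrix hat S, (N-1)x(N-1) with entries 1 + delta_jk (indices from 0 here).\<close>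
definition Shat :: "nat \<Rightarrow> nat \<Rightarrow> int" where
  "Shat j k = 1 + (if j = k then 1 else 0)"

end

theory Submission
  imports Defs
begin

text \<open>
  Write \<open>(y)\<close> for \<open>(y;q)\<^sub>\<infinity>\<close>, \<open>P(y) = (y)(q/y)\<close>, \<open>c = q\<^sup>\<alpha>\<close>, \<open>e(v) = exp(2\<pi>iv)\<close>, \<open>a = e(u\<^sub>0)\<close>, \<open>b = e(u\<^sub>0 - z)\<close>
  and \<open>x = e(u\<^sub>0 + u\<^sub>1)\<close>. Summing over \<open>n\<^sub>1\<close> first reduces the identity to one index, with \<open>a, b, x\<close>
  multiplied by \<open>q\<^sup>m\<close>, \<open>m = n\<^sub>2 + \<dots> + n\<^sub>N\<close>; the quasi-periodicity of \<open>P\<close> turns this shift into the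
  quadratic form on the right-hand side.

  For one index, multiplying the series by \<open>P(a)\<close> removes the denominators and gives
  \<open>\<Phi>(a) = \<Sum> (caq\<^sup>n) (q\<^bsup>1-n\<^esup>/a) a\<^bsup>2n\<^esup> x\<^bsup>-n\<^esup> q\<^bsup>n^2\<^esup>\<close>. Expanding both products by Euler's identity shows that \<open>\<Phi>\<close>
  lies in the two-dimensional space of theta functions spanned by \<open>\<Theta>\<^sub>0\<close> and \<open>\<Theta>\<^sub>1\<close> (the parts of
  even and odd degree in \<open>a\<close>), while by the Jacobi triple product \<open>h(a,b) = a P(b/a) P(x/(ab))\<close> is
  proportional to \<open>\<Theta>\<^sub>1(a) \<Theta>\<^sub>0(b) - \<Theta>\<^sub>0(a) \<Theta>\<^sub>1(b)\<close>. Hence \<open>\<Phi>(a) h(b,s) + \<Phi>(b) h(s,a) + \<Phi>(s) h(a,b) = 0\<close>,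
  and \<open>s = 1\<close> is the claim: the terms of \<open>\<Phi>(1)\<close> with \<open>n > 0\<close> vanish and the others form the
  \<open>\<^sub>1\<phi>\<^sub>1\<close> series.
\<close>

section \<open>Triangular exponents and signs\<close>

definition tri :: "int \<Rightarrow> int" where
  "tri n = n * (n - 1) div 2"

text \<open>The product is even, so the division in \<open>tri\<close> is exact. Later identities
  between exponents are proved by doubling and applying this, which keeps every exponent an
  integer.\<close>

lemma two_tri: "2 * tri n = n * (n - 1)"
  by (simp add: tri_def)

lemma tri_add: "tri (m + n) = tri m + tri n + m * n"
proof -
  have "2 * tri (m + n) = 2 * (tri m + tri n + m * n)"
    by (simp only: two_tri distrib_left) (simp add: algebra_simps)
  then show ?thesis by simp
qed

lemma tri_uminus: "tri (- n) = tri n + n"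
proof -
  have "2 * tri (- n) = 2 * (tri n + n)"
    by (simp only: two_tri distrib_left) (simp add: algebra_simps)
  then show ?thesis by simp
qed

lemma tri_of_nat: "tri (int n) = int (n * (n - 1) div 2)"
  by (cases n) (simp_all add: tri_def zdiv_int algebra_simps)

lemma tri_simps [simp]: "tri 0 = 0" "tri 1 = 0" "tri (-1) = 1"
  by (simp_all add: tri_def)

lemma power_int_neg_one_add: "(-1 :: complex) powi (m + n) = (-1) powi m * (-1) powi n"
  by (simp add: power_int_add)

lemma power_int_neg_one_square [simp]: "(-1 :: complex) powi m * (-1) powi m = 1"
  by (metis mult_minus1 mult_minus1_right power_int_1_left power_int_mult_distrib minus_minus)

section \<open>Summability over integers, products and lists; finite sums and products\<close>

lemma summable_on_times_nonneg:
  fixes f :: "'a \<Rightarrow> real" and g :: "'b \<Rightarrow> real"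
  assumes "f summable_on A" "g summable_on B" "\<And>x. x \<in> A \<Longrightarrow> f x \<ge> 0" "\<And>y. y \<in> B \<Longrightarrow> g y \<ge> 0"
  shows "(\<lambda>(x, y). f x * g y) summable_on (A \<times> B)"
proof (rule summable_on_SigmaI)
  fix x assume "x \<in> A"
  show "((\<lambda>y. case (x, y) of (x, y) \<Rightarrow> f x * g y) has_sum f x * infsum g B) B"
    using assms(2) by (simp add: has_sum_cmult_right)
next
  show "(\<lambda>x. f x * infsum g B) summable_on A"
    by (rule summable_on_cmult_left) fact
qed (use assms in auto)

lemma abs_summable_on_int:
  fixes f :: "int \<Rightarrow> 'a :: banach"
  assumes "summable (\<lambda>n::nat. norm (f (int n)))" "summable (\<lambda>n::nat. norm (f (- int n)))"
  shows "(\<lambda>n. norm (f n)) summable_on UNIV"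
proof -
  have "(\<lambda>n. norm (f n)) summable_on (range int)"
    by (subst summable_on_reindex) (use assms in \<open>auto intro!: norm_summable_imp_summable_on simp: o_def\<close>)
  moreover have "(\<lambda>n. norm (f n)) summable_on (range (\<lambda>n. - int n))"
    by (subst summable_on_reindex)
      (use assms in \<open>auto intro!: norm_summable_imp_summable_on inj_onI simp: o_def\<close>)
  ultimately have "(\<lambda>n. norm (f n)) summable_on (range int \<union> range (\<lambda>n. - int n))"
    by (rule summable_on_union)
  moreover have "range int \<union> range (\<lambda>n. - int n) = UNIV"
    by (auto simp: image_iff) (metis int_cases2)
  ultimately show ?thesis by simp
qed

lemma summable_ratio_tendsto_0:
  fixes f :: "nat \<Rightarrow> 'a :: banach"
  assumes "\<And>n. norm (f (Suc n)) \<le> r n * norm (f n)" "r \<longlonglongrightarrow> 0"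
  shows "summable (\<lambda>n. norm (f n))"
proof -
  have "\<forall>\<^sub>F n in sequentially. r n < 1/2"
    using assms(2) by (rule order_tendstoD) simp
  then obtain N where N: "\<And>n. n \<ge> N \<Longrightarrow> r n < 1/2"
    by (auto simp: eventually_sequentially)
  show ?thesis
  proof (rule summable_ratio_test[where c = "1/2" and N = N])
    fix n assume "n \<ge> N"
    then have "r n * norm (f n) \<le> 1/2 * norm (f n)"
      using N[of n] by (intro mult_right_mono) auto
    then show "norm (norm (f (Suc n))) \<le> 1/2 * norm (norm (f n))"
      using assms(1)[of n] by simp
  qed simp
qed

text \<open>The ratio of consecutive terms is \<open>\<rho> ^ n * R\<close> going up and
  \<open>\<rho> ^ n * (\<rho> / R)\<close> going down. Both tend to 0, so each half of the series
  passes the ratio test.\<close>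

lemma summable_on_gauss:
  fixes \<rho> R :: real
  assumes "0 < \<rho>" "\<rho> < 1" "0 < R"
  shows "(\<lambda>n. \<rho> powi tri n * R powi n) summable_on UNIV"
proof -
  define f where "f = (\<lambda>n. \<rho> powi tri n * R powi n)"
  have pos: "f n > 0" for n
    using assms by (simp add: f_def)
  have lim: "(\<lambda>n. \<rho> ^ n * c) \<longlonglongrightarrow> 0" for c
    using LIMSEQ_realpow_zero[of \<rho>] assms by (intro tendsto_mult_left_zero) auto
  have "f (n + 1) = \<rho> powi n * R * f n" for n
    using assms by (simp add: f_def tri_add power_int_add)
  then have "norm (f (int (Suc n))) \<le> (\<rho> ^ n * R) * norm (f (int n))" for n
    using pos assms by (simp add: add.commute[of 1] abs_mult)
  then have 1: "summable (\<lambda>n. norm (f (int n)))"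
    by (rule summable_ratio_tendsto_0) (rule lim)
  have "f (n - 1) = \<rho> powi (-n) * (\<rho> / R) * f n" for n
  proof -
    have "tri (n - 1) = - n + 1 + tri n"
      using tri_add[of n "-1"] by simp
    then have "f (n - 1) = \<rho> powi (- n + 1 + tri n) * R powi (n - 1)"
      by (simp only: f_def)
    then show ?thesis
      using assms by (simp add: f_def power_int_add power_int_diff power_int_minus_divide)
  qed
  from this[of "- int n" for n] have "f (- int (Suc n)) = \<rho> ^ n * (\<rho> / R) * f (- int n)" for n
    by (simp add: minus_diff_commute)
  then have "norm (f (- int (Suc n))) \<le> (\<rho> ^ n * (\<rho> / R)) * norm (f (- int n))" for n
    using assms by (simp add: norm_mult abs_mult)
  then have 2: "summable (\<lambda>n. norm (f (- int n)))"
    by (rule summable_ratio_tendsto_0) (rule lim)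
  have "(\<lambda>n. norm (f n)) summable_on UNIV"
    by (rule abs_summable_on_int) fact+
  moreover have "(\<lambda>n. norm (f n)) = f"
    using pos by (intro ext) (simp add: less_imp_le)
  ultimately show ?thesis by (simp add: f_def)
qed

lemma power_int_abs_le:
  fixes x :: real
  assumes "x > 0"
  shows "x powi n \<le> (max x (1 / x)) ^ nat \<bar>n\<bar>"
proof (cases "n \<ge> 0")
  case True
  then show ?thesis using assms by (simp add: power_int_def power_mono)
next
  case False
  then have "x powi n = (1 / x) ^ nat \<bar>n\<bar>"
    by (simp add: power_int_def power_one_over inverse_eq_divide)
  also have "\<dots> \<le> (max x (1 / x)) ^ nat \<bar>n\<bar>"
    using assms by (intro power_mono) auto
  finally show ?thesis .
qed

text \<open>Since \<open>W ^ nat \<bar>n\<bar>\<close> is at most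
  \<open>W powi n + (1 / W) powi n\<close>, two Gaussian series dominate. The extra factor absorbs
  growth that is exponential in the absolute value of the index.\<close>

lemma summable_on_gauss_abs:
  fixes \<rho> R W :: real
  assumes "0 < \<rho>" "\<rho> < 1" "0 < R" "0 < W"
  shows "(\<lambda>n. \<rho> powi tri n * R powi n * W ^ nat \<bar>n\<bar>) summable_on UNIV"
proof (rule summable_on_comparison_test)
  show "(\<lambda>n. \<rho> powi tri n * (R * W) powi n + \<rho> powi tri n * (R / W) powi n) summable_on UNIV"
    using assms by (intro summable_on_add summable_on_gauss) auto
  fix n :: int
  have "W ^ nat \<bar>n\<bar> \<le> W powi n + (1 / W) powi n"
    using assms by (cases "n \<ge> 0") (auto simp: power_int_def field_simps)
  then have "\<rho> powi tri n * R powi n * W ^ nat \<bar>n\<bar> \<le> \<rho> powi tri n * R powi n * (W powi n + (1 / W) powi n)"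
    using assms by (intro mult_left_mono) auto
  then show "\<rho> powi tri n * R powi n * W ^ nat \<bar>n\<bar>
      \<le> \<rho> powi tri n * (R * W) powi n + \<rho> powi tri n * (R / W) powi n"
    by (simp add: power_int_mult_distrib power_int_divide_distrib field_simps)
qed (use assms in auto)

lemma summable_on_geometric_abs: "(\<lambda>n::int. (1/2 :: real) ^ nat \<bar>n\<bar>) summable_on UNIV"
proof -
  have "(\<lambda>n::int. norm ((1/2 :: real) ^ nat \<bar>n\<bar>)) summable_on UNIV"
    by (rule abs_summable_on_int) (simp_all add: norm_power)
  then show ?thesis by (simp add: norm_power)
qed

lemma qpoch_0 [simp]: "qpoch x q 0 = 1"
  by (simp add: qpoch_def)

lemma qpoch_Suc: "qpoch x q (Suc n) = qpoch x q n * (1 - x * q ^ n)"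
  by (simp add: qpoch_def)

lemma qpoch_Suc_shift: "qpoch x q (Suc n) = (1 - x) * qpoch (x * q) q n"
  unfolding qpoch_def prod.lessThan_Suc_shift by (simp add: mult.assoc)

lemma infsum_int_shift: "(\<Sum>\<^sub>\<infinity>n\<in>UNIV. f (n + k)) = (\<Sum>\<^sub>\<infinity>n\<in>(UNIV :: int set). f n)"
  by (rule infsum_reindex_bij_betw) (rule bij_plus_right)

lemma abs_summable_on_times:
  fixes f :: "'a \<Rightarrow> complex" and g :: "'b \<Rightarrow> complex"
  assumes "(\<lambda>x. norm (f x)) summable_on A" "(\<lambda>y. norm (g y)) summable_on B"
  shows "(\<lambda>(x, y). f x * g y) summable_on (A \<times> B)"
proof (rule abs_summable_summable)
  show "(\<lambda>z. norm (case z of (x, y) \<Rightarrow> f x * g y)) summable_on (A \<times> B)"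
    using summable_on_times_nonneg[OF assms] by (simp add: case_prod_unfold norm_mult)
qed

lemma has_sum_times:
  fixes f :: "'a \<Rightarrow> complex" and g :: "'b \<Rightarrow> complex"
  assumes "(\<lambda>x. norm (f x)) summable_on A" "(\<lambda>y. norm (g y)) summable_on B"
  shows "((\<lambda>(x, y). f x * g y) has_sum (infsum f A * infsum g B)) (A \<times> B)"
proof -
  have "infsum (\<lambda>(x, y). f x * g y) (A \<times> B) = (\<Sum>\<^sub>\<infinity>x\<in>A. \<Sum>\<^sub>\<infinity>y\<in>B. f x * g y)"
    by (rule infsum_Sigma'_banach[symmetric]) (rule abs_summable_on_times[OF assms])
  also have "\<dots> = infsum f A * infsum g B"
    by (simp add: infsum_cmult_right' infsum_cmult_left')
  finally show ?thesis
    using abs_summable_on_times[OF assms] by (simp add: has_sum_iff)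
qed

lemma power_int_diff_power:
  fixes y :: "'a :: field"
  assumes "y \<noteq> 0"
  shows "(y powi (1 - n)) ^ l = y ^ l * y powi (- n * int l)"
proof -
  have "(y powi (1 - n)) ^ l = y powi (int l + (- n * int l))"
    by (simp only: power_int_power') (simp add: algebra_simps)
  then show ?thesis using assms by (simp only: power_int_add power_int_of_nat simp_thms)
qed

lemma bij_betw_Cons: "bij_betw (\<lambda>(n, r). n # r) (UNIV \<times> {r. length r = k}) {r :: 'a list. length r = Suc k}"
  by (rule bij_betwI[where g = "\<lambda>r. (hd r, tl r)"]) (auto simp: length_Suc_conv)

lemma prod_nth_Cons: "(\<Prod>j<Suc k. f j ((n # r) ! j)) = f 0 n * (\<Prod>j<k. f (Suc j) (r ! j))"
  unfolding prod.lessThan_Suc_shift by simp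

lemma summable_on_lists:
  fixes g :: "nat \<Rightarrow> 'a \<Rightarrow> real"
  assumes "\<And>j. g j summable_on UNIV" "\<And>j n. g j n \<ge> 0"
  shows "(\<lambda>ns. \<Prod>j<k. g j (ns ! j)) summable_on {ns. length ns = k}"
  using assms
proof (induction k arbitrary: g)
  case (Suc k)
  have "(\<lambda>(n, r). g 0 n * (\<Prod>j<k. g (Suc j) (r ! j))) summable_on (UNIV \<times> {r. length r = k})"
    by (intro summable_on_times_nonneg Suc prod_nonneg)
  then have "(\<lambda>z. (\<lambda>ns. \<Prod>j<Suc k. g j (ns ! j)) ((\<lambda>(n, r). n # r) z)) summable_on (UNIV \<times> {r. length r = k})"
    by (simp add: case_prod_unfold prod_nth_Cons del: prod.lessThan_Suc)
  then show ?case
    using summable_on_reindex_bij_betw[OF bij_betw_Cons] by blast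
qed simp

lemma prod_power_int:
  fixes y :: "'a :: field"
  assumes "y \<noteq> 0"
  shows "(\<Prod>j\<in>A. y powi f j) = y powi (\<Sum>j\<in>A. f j)"
  using assms by (induction A rule: infinite_finite_induct) (simp_all add: power_int_add)

text \<open>\<open>Shat\<close> is the all-ones matrix plus the identity; the former contributes the
  square of the sum, the latter the sum of squares.\<close>

lemma Shat_quadratic_form:
  "(\<Sum>j<k. \<Sum>l<k. Shat j l * r j * r l) = (\<Sum>j<k. r j) * (\<Sum>j<k. r j) + (\<Sum>j<k. r j * r j)"
proof -
  have "Shat j l * r j * r l = r j * r l + (if l = j then r j * r j else 0)" for j l
    by (auto simp: Shat_def)
  then have "(\<Sum>j<k. \<Sum>l<k. Shat j l * r j * r l)
      = (\<Sum>j<k. \<Sum>l<k. r j * r l) + (\<Sum>j<k. \<Sum>l<k. if l = j then r j * r j else 0)"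
    by (simp add: sum.distrib)
  also have "(\<Sum>j<k. \<Sum>l<k. if l = j then r j * r j else 0) = (\<Sum>j<k. r j * r j)"
    by (rule sum.cong) (simp_all add: sum.delta')
  finally show ?thesis by (simp add: sum_product)
qed

lemma sum_list_eq_sum: "length r = k \<Longrightarrow> sum_list r = (\<Sum>j<k. r ! j)"
  by (simp add: sum_list_sum_nth atLeast0LessThan)

text \<open>In multiplicative variables only \<open>q\<close> enters; \<open>\<tau>\<close> and the
  lattice return when the result is translated back to theta functions.\<close>

locale nome_base =
  fixes q :: complex
  assumes q_nz: "q \<noteq> 0" and q_lt_1: "norm q < 1"
begin

subsection \<open>Euler's identities\<close>

lemma q_power_tendsto_0: "(\<lambda>n. q ^ n) \<longlonglongrightarrow> 0"
  by (rule LIMSEQ_power_zero) (rule q_lt_1)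

lemma q_power_Suc_neq_1: "q ^ Suc n \<noteq> 1"
proof
  assume "q ^ Suc n = 1"
  then have "norm q ^ Suc n = 1" by (metis norm_power norm_one)
  moreover have "norm q ^ Suc n < 1"
    using q_lt_1 q_nz by (intro power_Suc_less_one) auto
  ultimately show False by simp
qed

lemma qpoch_q_nz [simp]: "qpoch q q n \<noteq> 0"
  using q_power_Suc_neq_1 by (auto simp: qpoch_def)

text \<open>The coefficients in Euler's expansion of the infinite product \<open>qinf y\<close> in
  powers of \<open>y\<close>.\<close>

definition eul :: "nat \<Rightarrow> complex" where
  "eul k = (-1) ^ k * q ^ (k * (k - 1) div 2) / qpoch q q k"

lemma eul_eq: "eul k = (-1) powi (int k) * q powi tri (int k) / qpoch q q k"
  by (simp add: eul_def tri_of_nat)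

lemma eul_0 [simp]: "eul 0 = 1"
  by (simp add: eul_def)

lemma eul_Suc: "eul (Suc k) * (1 - q ^ Suc k) = - (q ^ k * eul k)"
proof -
  have "tri (int (Suc k)) = tri (int k) + int k"
    by (simp add: tri_add add.commute[of 1])
  then show ?thesis
    using q_nz q_power_Suc_neq_1[of k]
    by (simp add: eul_eq qpoch_Suc power_int_add add.commute[of 1])
qed

lemma eul_ratio_tendsto_0: "(\<lambda>k. norm (q ^ k / (1 - q ^ Suc k) * y)) \<longlonglongrightarrow> 0"
proof -
  have "(\<lambda>k. q ^ k / (1 - q * q ^ k) * y) \<longlonglongrightarrow> 0 / (1 - q * 0) * y"
    by (intro tendsto_intros q_power_tendsto_0) auto
  then show ?thesis by (intro tendsto_norm_zero) simp
qed

lemma summable_norm_eul: "summable (\<lambda>k. norm (eul k * y ^ k))"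
proof (rule summable_ratio_tendsto_0)
  fix k
  have "eul (Suc k) = - (q ^ k / (1 - q ^ Suc k)) * eul k"
    using eul_Suc[of k] q_power_Suc_neq_1[of k] by (simp add: field_simps)
  then show "norm (eul (Suc k) * y ^ Suc k) \<le> norm (q ^ k / (1 - q ^ Suc k) * y) * norm (eul k * y ^ k)"
    by (simp add: norm_mult norm_divide norm_power mult_ac)
qed (rule eul_ratio_tendsto_0)

lemma summable_eul: "summable (\<lambda>k. eul k * y ^ k)"
  using summable_norm_eul by (rule summable_norm_cancel)

text \<open>The recurrence \<open>eul_Suc\<close> for the coefficients makes the series satisfy the
  functional equation of the infinite product.\<close>

lemma eul_functional: "(\<Sum>k. eul k * y ^ k) = (1 - y) * (\<Sum>k. eul k * (y * q) ^ k)"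
proof -
  have "(\<lambda>k. eul k * y ^ k - eul k * (y * q) ^ k) sums
      ((\<Sum>k. eul k * y ^ k) - (\<Sum>k. eul k * (y * q) ^ k))"
    by (intro sums_diff summable_sums summable_eul)
  \<comment> \<open>The terms of index 0 cancel, so the difference starts at index 1.\<close>
  then have "(\<lambda>k. eul (Suc k) * y ^ Suc k - eul (Suc k) * (y * q) ^ Suc k) sums
      ((\<Sum>k. eul k * y ^ k) - (\<Sum>k. eul k * (y * q) ^ k))"
    by (subst sums_Suc_iff) simp
  moreover have "eul (Suc k) * y ^ Suc k - eul (Suc k) * (y * q) ^ Suc k = - y * (eul k * (y * q) ^ k)" for k
  proof -
    have "eul (Suc k) * y ^ Suc k - eul (Suc k) * (y * q) ^ Suc k
        = (eul (Suc k) * (1 - q ^ Suc k)) * y ^ Suc k"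
      by (simp add: algebra_simps power_mult_distrib)
    then show ?thesis
      by (simp only: eul_Suc) (simp add: power_mult_distrib algebra_simps)
  qed
  ultimately have "(\<lambda>k. - y * (eul k * (y * q) ^ k)) sums
      ((\<Sum>k. eul k * y ^ k) - (\<Sum>k. eul k * (y * q) ^ k))" by simp
  moreover have "(\<lambda>k. - y * (eul k * (y * q) ^ k)) sums (- y * (\<Sum>k. eul k * (y * q) ^ k))"
    by (intro sums_mult summable_sums summable_eul)
  ultimately have "(\<Sum>k. eul k * y ^ k) - (\<Sum>k. eul k * (y * q) ^ k) = - y * (\<Sum>k. eul k * (y * q) ^ k)"
    by (rule sums_unique2)
  then show ?thesis by (simp add: algebra_simps)
qed

lemma eul_functional_iterate: "(\<Sum>k. eul k * y ^ k) = qpoch y q n * (\<Sum>k. eul k * (y * q ^ n) ^ k)"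
  by (induction n) (simp_all add: qpoch_Suc eul_functional[of "y * q ^ n" for n] mult_ac)

lemma eul_tendsto_1:
  assumes "(f \<longlongrightarrow> 0) F"
  shows "((\<lambda>n. \<Sum>k. eul k * f n ^ k) \<longlongrightarrow> 1) F"
proof -
  have "isCont (\<lambda>y. \<Sum>k. eul k * y ^ k) 0"
    by (rule isCont_powser[where K = 1]) (use summable_eul[of 1] in auto)
  then have "((\<lambda>n. \<Sum>k. eul k * f n ^ k) \<longlongrightarrow> (\<Sum>k. eul k * 0 ^ k)) F"
    using assms by (rule isCont_tendsto_compose)
  then show ?thesis by simp
qed

text \<open>Iterating the functional equation \<open>n\<close> times leaves the series at
  \<open>y * q ^ n\<close>, which tends to 1. This also supplies the convergence that gives
  \<open>lim\<close> in \<open>qpoch_inf\<close> its meaning.\<close>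

lemma qpoch_tendsto_eul: "(\<lambda>n. qpoch y q n) \<longlonglongrightarrow> (\<Sum>k. eul k * y ^ k)"
proof -
  define E where "E = (\<lambda>n. \<Sum>k. eul k * (y * q ^ n) ^ k)"
  have lim: "E \<longlonglongrightarrow> 1"
    unfolding E_def by (rule eul_tendsto_1, rule tendsto_mult_right_zero, rule q_power_tendsto_0)
  then have "(\<lambda>n. (\<Sum>k. eul k * y ^ k) / E n) \<longlonglongrightarrow> (\<Sum>k. eul k * y ^ k) / 1"
    by (intro tendsto_intros) auto
  \<comment> \<open>\<open>E n\<close> can vanish for small \<open>n\<close>, so the division is
    justified only eventually.\<close>
  moreover have "\<forall>\<^sub>F n in sequentially. E n \<noteq> 0"
    by (rule tendsto_imp_eventually_ne[OF lim]) simp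
  then have "\<forall>\<^sub>F n in sequentially. (\<Sum>k. eul k * y ^ k) / E n = qpoch y q n"
    by eventually_elim (use eul_functional_iterate[of y] in \<open>simp add: E_def field_simps\<close>)
  ultimately show ?thesis
    by (simp add: tendsto_cong)
qed

abbreviation qinf :: "complex \<Rightarrow> complex" where
  "qinf y \<equiv> qpoch_inf y q"

lemma qinf_eq_eul: "qinf y = (\<Sum>k. eul k * y ^ k)"
  unfolding qpoch_inf_def by (rule limI) (rule qpoch_tendsto_eul)

lemma qinf_has_sum: "((\<lambda>k. eul k * y ^ k) has_sum qinf y) UNIV"
  unfolding qinf_eq_eul
  by (rule norm_summable_imp_has_sum[OF summable_norm_eul]) (rule summable_sums[OF summable_eul])

lemma qpoch_tendsto: "(\<lambda>n. qpoch y q n) \<longlonglongrightarrow> qinf y"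
  unfolding qinf_eq_eul by (rule qpoch_tendsto_eul)

lemma qinf_tendsto_1: "(f \<longlongrightarrow> 0) F \<Longrightarrow> ((\<lambda>n. qinf (f n)) \<longlongrightarrow> 1) F"
  unfolding qinf_eq_eul by (rule eul_tendsto_1)

lemma qinf_shift: "qinf y = qpoch y q n * qinf (y * q ^ n)"
  unfolding qinf_eq_eul by (rule eul_functional_iterate)

lemma qinf_step: "qinf y = (1 - y) * qinf (y * q)"
  using qinf_shift[of y 1] by (simp add: qpoch_def)

text \<open>A far enough tail of the product is close to 1, hence nonzero, and only finitely many
  nonzero factors precede it.\<close>

lemma qinf_nz:
  assumes "\<And>n. y * q ^ n \<noteq> 1"
  shows "qinf y \<noteq> 0"
proof -
  have "(\<lambda>n. qinf (y * q ^ n)) \<longlonglongrightarrow> 1"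
    by (rule qinf_tendsto_1, rule tendsto_mult_right_zero, rule q_power_tendsto_0)
  then have "\<forall>\<^sub>F n in sequentially. qinf (y * q ^ n) \<noteq> 0"
    by (rule tendsto_imp_eventually_ne) simp
  then obtain n where "qinf (y * q ^ n) \<noteq> 0"
    by (auto simp: eventually_sequentially)
  moreover have "qpoch y q n \<noteq> 0"
    using assms by (auto simp: qpoch_def)
  ultimately show ?thesis by (subst qinf_shift[of y n]) simp
qed

lemma qinf_q_nz [simp]: "qinf q \<noteq> 0"
  by (rule qinf_nz) (use q_power_Suc_neq_1 in auto)

lemma qinf_q_power: "qinf (q ^ Suc n) = qinf q / qpoch q q n"
  using qinf_shift[of q n] by simp

text \<open>The factor of index \<open>nat (-n)\<close> is
  \<open>1 - q powi n * q ^ nat (-n) = 0\<close>. This cuts two-sided series down to a half-line, in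
  the triple product and in \<open>Phi_1\<close>.\<close>

lemma qinf_power_int_nonpos: "n \<le> 0 \<Longrightarrow> qinf (q powi n) = 0"
proof -
  assume "n \<le> 0"
  have "qpoch (q powi n) q (Suc (nat (-n))) = 0"
    using \<open>n \<le> 0\<close> q_nz by (simp add: qpoch_Suc power_int_def power_mult_distrib[symmetric])
  then show ?thesis by (subst qinf_shift[of _ "Suc (nat (-n))"]) simp
qed

text \<open>The sequence converges, because \<open>qpoch q q n\<close> tends to the nonzero limit
  \<open>qinf q\<close>.\<close>

lemma inverse_qpoch_q_bounded: obtains B where "B > 0" "\<And>n. norm (1 / qpoch q q n) \<le> B"
proof -
  have "(\<lambda>n. 1 / qpoch q q n) \<longlonglongrightarrow> 1 / qinf q"
    by (intro tendsto_intros qpoch_tendsto) simp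
  then have "Bseq (\<lambda>n. 1 / qpoch q q n)"
    by (rule convergent_imp_Bseq[OF convergentI])
  then show ?thesis using that by (auto elim: BseqE)
qed

lemma norm_eul_le:
  assumes "\<And>n. norm (1 / qpoch q q n) \<le> B"
  shows "norm (eul k) \<le> B * norm q powi tri (int k)"
proof -
  have "norm (eul k) = norm (1 / qpoch q q k) * norm q powi tri (int k)"
    by (simp add: eul_eq norm_mult norm_divide norm_power_int norm_power)
  also have "\<dots> \<le> B * norm q powi tri (int k)"
    by (intro mult_right_mono assms) simp
  finally show ?thesis .
qed

lemma summable_power_over_qpoch:
  assumes "norm y < 1"
  shows "summable (\<lambda>k. norm (y ^ k / qpoch q q k))"
proof -
  obtain B where B: "\<And>n. norm (1 / qpoch q q n) \<le> B" using inverse_qpoch_q_bounded by blast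
  show ?thesis
  proof (rule summable_comparison_test')
    show "summable (\<lambda>k. B * norm y ^ k)"
      using assms by (intro summable_mult summable_geometric) simp
    fix n
    have "norm (1 / qpoch q q n) * norm y ^ n \<le> B * norm y ^ n"
      by (intro mult_right_mono B) simp
    then show "norm (norm (y ^ n / qpoch q q n)) \<le> B * norm y ^ n"
      by (simp add: norm_divide norm_power)
  qed
qed

text \<open>Euler's second identity, the expansion of \<open>1 / qinf y\<close> in the unit disk.
  The series \<open>e\<close> satisfies \<open>(1 - y) * e y = e (y * q)\<close>; iterating and
  letting \<open>n\<close> grow gives \<open>qinf y * e y = e 0 = 1\<close>.\<close>

lemma suminf_power_over_qpoch:
  assumes "norm y < 1"
  shows "(\<Sum>k. y ^ k / qpoch q q k) * qinf y = 1"
proof -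
  define e where "e = (\<lambda>y. \<Sum>k. y ^ k / qpoch q q k)"
  have yq: "norm (y * q) < 1" if "norm y < 1" for y
    using that q_lt_1 mult_strict_mono[of "norm y" 1 "norm q" 1] by (simp add: norm_mult)
  have yqn: "norm (y * q ^ n) < 1" for n
  proof (induction n)
    case (Suc n)
    then show ?case using yq[of "y * q ^ n"] by (simp add: mult_ac)
  qed (use assms in simp)
  have summ: "summable (\<lambda>k. y ^ k / qpoch q q k)" if "norm y < 1" for y
    using summable_power_over_qpoch[OF that] by (rule summable_norm_cancel)
  have step: "(1 - y) * e y = e (y * q)" if "norm y < 1" for y
  proof -
    have "(\<lambda>k. y ^ k / qpoch q q k - (y * q) ^ k / qpoch q q k) sums (e y - e (y * q))"
      unfolding e_def by (intro sums_diff summable_sums summ yq that)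
    then have "(\<lambda>k. y ^ Suc k / qpoch q q (Suc k) - (y * q) ^ Suc k / qpoch q q (Suc k)) sums (e y - e (y * q))"
      by (subst sums_Suc_iff) simp
    moreover have "y ^ Suc k / qpoch q q (Suc k) - (y * q) ^ Suc k / qpoch q q (Suc k)
        = y * (y ^ k / qpoch q q k)" for k
      using q_power_Suc_neq_1[of k]
      by (simp add: qpoch_Suc divide_simps power_mult_distrib) (simp add: algebra_simps)
    ultimately have "(\<lambda>k. y * (y ^ k / qpoch q q k)) sums (e y - e (y * q))"
      by simp
    moreover have "(\<lambda>k. y * (y ^ k / qpoch q q k)) sums (y * e y)"
      unfolding e_def by (intro sums_mult summable_sums summ that)
    ultimately have "e y - e (y * q) = y * e y" by (rule sums_unique2)
    then show ?thesis by (simp add: algebra_simps)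
  qed
  have iter: "qpoch y q n * e y = e (y * q ^ n)" for n
  proof (induction n)
    case (Suc n)
    have "qpoch y q (Suc n) * e y = (1 - y * q ^ n) * (qpoch y q n * e y)"
      by (simp add: qpoch_Suc)
    also have "\<dots> = e (y * q ^ n * q)"
      unfolding Suc using step[OF yqn[of n]] .
    finally show ?case by (simp add: mult_ac)
  qed simp
  \<comment> \<open>The auxiliary point \<open>1/2\<close> lies inside the unit disk of convergence
    and is farther out than 0.\<close>
  have "isCont e 0"
    unfolding e_def
    using isCont_powser[where K = "1/2" and c = "\<lambda>k. 1 / qpoch q q k" and x = 0] summ[of "1/2"]
    by simp
  moreover have "(\<lambda>n. y * q ^ n) \<longlonglongrightarrow> 0"
    by (rule tendsto_mult_right_zero, rule q_power_tendsto_0)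
  ultimately have "(\<lambda>n. e (y * q ^ n)) \<longlonglongrightarrow> e 0"
    by (rule isCont_tendsto_compose)
  moreover have "e 0 = 1"
    unfolding e_def using powser_zero[of "\<lambda>k. 1 / qpoch q q k"] by simp
  moreover have "(\<lambda>n. qpoch y q n * e y) \<longlonglongrightarrow> qinf y * e y"
    by (intro tendsto_intros qpoch_tendsto)
  ultimately have "qinf y * e y = 1"
    unfolding iter using LIMSEQ_unique by metis
  then show ?thesis by (simp add: e_def mult.commute)
qed

subsection \<open>The Jacobi triple product\<close>

definition thprod :: "complex \<Rightarrow> complex" where
  "thprod y = qinf y * qinf (q / y)"

definition jterm :: "complex \<Rightarrow> int \<Rightarrow> complex" where
  "jterm y n = (-1) powi n * q powi tri n * y powi n"

definition jsum :: "complex \<Rightarrow> complex" where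
  "jsum y = (\<Sum>\<^sub>\<infinity>n. jterm y n)"

text \<open>Stated for an arbitrary \<open>F\<close> because it serves both sides of the triple
  product, \<open>thprod\<close> and \<open>jsum\<close>.\<close>

lemma quasi_periodic_iterate:
  fixes F :: "complex \<Rightarrow> complex"
  assumes F: "\<And>y. y \<noteq> 0 \<Longrightarrow> F (y * q) = - F y / y" and y: "y \<noteq> 0"
  shows "F (y * q powi m) = (-1) powi m * y powi (-m) * q powi (- tri m) * F y"
proof -
  have up: "F (y * q powi (n + 1)) = - F (y * q powi n) / (y * q powi n)" for n
    using F[of "y * q powi n"] y q_nz by (simp add: power_int_add mult_ac)
  show ?thesis
  proof (induction m rule: int_induct[where k = 0])
    case (step1 i)
    have "F (y * q powi (i + 1))
        = - ((-1) powi i * y powi (-i) * q powi (- tri i) * F y) / (y * q powi i)"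
      by (simp only: up step1)
    also have "\<dots> = (-1) powi (i + 1) * y powi (- (i + 1)) * q powi (- tri (i + 1)) * F y"
      using y q_nz by (simp add: tri_add power_int_add power_int_diff power_int_minus field_simps)
    finally show ?case .
  next
    case (step2 i)
    have t: "tri i = tri (i - 1) + (i - 1)"
      using tri_add[of "i - 1" 1] by simp
    have "F (y * q powi (i - 1)) = - F (y * q powi i) * (y * q powi (i - 1))"
      using up[of "i - 1"] y q_nz by (simp add: field_simps)
    also have "\<dots> = - ((-1) powi i * y powi (-i) * q powi (- tri i) * F y) * (y * q powi (i - 1))"
      by (simp only: step2)
    also have "\<dots> = (-1) powi (i - 1) * y powi (- (i - 1)) * q powi (- tri (i - 1)) * F y"
      unfolding t using y q_nz
      by (simp add: power_int_add power_int_diff power_int_minus field_simps)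
    finally show ?case .
  qed (simp)
qed

text \<open>Replacing \<open>y\<close> by \<open>y * q\<close> drops the factor \<open>1 - y\<close>
  from the first product and adds \<open>1 - 1 / y\<close> to the second; their quotient is
  \<open>- 1 / y\<close>.\<close>

lemma thprod_step:
  assumes "y \<noteq> 0"
  shows "thprod (y * q) = - thprod y / y"
proof -
  have "qinf (1 / y) = (1 - 1 / y) * qinf (q / y)"
    using qinf_step[of "1 / y"] by simp
  then have "thprod (y * q) = (1 - 1 / y) * (qinf (y * q) * qinf (q / y))"
    using q_nz by (simp add: thprod_def)
  also have "\<dots> = - ((1 - y) * qinf (y * q) * qinf (q / y)) / y"
    using assms by (simp add: field_simps)
  finally show ?thesis
    by (simp only: thprod_def qinf_step[of y])
qed

lemma thprod_shift:
  "y \<noteq> 0 \<Longrightarrow> thprod (y * q powi m) = (-1) powi m * y powi (-m) * q powi (- tri m) * thprod y"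
  by (rule quasi_periodic_iterate[OF thprod_step])

text \<open>The product is symmetric under exchanging \<open>y\<close> and \<open>q / y\<close>, so
  its value at \<open>1 / y\<close> equals that at \<open>y * q\<close>.\<close>

lemma thprod_inverse:
  assumes "y \<noteq> 0"
  shows "thprod (1 / y) = - thprod y / y"
  using thprod_step[OF assms] assms q_nz by (simp add: thprod_def mult_ac)

lemma jterm_summable:
  assumes "y \<noteq> 0"
  shows "(\<lambda>n. norm (jterm y n)) summable_on UNIV"
proof -
  have "(\<lambda>n. norm (jterm y n)) = (\<lambda>n. norm q powi tri n * norm y powi n)"
    by (simp add: jterm_def norm_mult norm_power_int)
  then show ?thesis
    using summable_on_gauss[of "norm q" "norm y"] assms q_nz q_lt_1 by simp
qed

lemma jsum_step:
  assumes "y \<noteq> 0"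
  shows "jsum (y * q) = - jsum y / y"
proof -
  have "jterm (y * q) n = - 1 / y * jterm y (n + 1)" for n
    using assms q_nz
    by (simp add: jterm_def tri_add power_int_add power_int_mult_distrib)
  then have "jsum (y * q) = (\<Sum>\<^sub>\<infinity>n. - 1 / y * jterm y (n + 1))"
    by (simp add: jsum_def)
  also have "\<dots> = - 1 / y * jsum y"
    unfolding jsum_def by (simp only: infsum_cmult_right' infsum_int_shift[of "jterm y"])
  finally show ?thesis by simp
qed

text \<open>The hypothesis puts \<open>q / y\<close> into the unit disk, where
  \<open>1 / qinf (q / y)\<close> has Euler's expansion.\<close>

lemma triple_product_annulus:
  assumes y: "norm q < norm y"
  shows "qinf q * thprod y = jsum y"
proof -
  have y0: "y \<noteq> 0" using y by auto
  define b where "b = (\<lambda>m. (q / y) ^ m / qpoch q q m)"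
  have qy: "norm (q / y) < 1"
    using y y0 by (simp add: norm_divide)
  have b: "(\<lambda>m. norm (b m)) summable_on UNIV"
    using summable_power_over_qpoch[OF qy] unfolding b_def
    by (intro norm_summable_imp_summable_on) simp
  have inf_b: "infsum b UNIV = (\<Sum>m. b m)"
    by (rule infsumI, rule norm_summable_imp_has_sum)
       (use summable_power_over_qpoch[OF qy] in \<open>auto simp: b_def intro!: summable_sums summable_norm_cancel\<close>)
  define t where "t = (\<lambda>(N, m). jterm y N * b m)"
  have t: "(t has_sum (jsum y * (\<Sum>m. b m))) (UNIV \<times> UNIV)"
    using has_sum_times[OF jterm_summable[OF y0] b] unfolding t_def jsum_def inf_b .
  \<comment> \<open>In the double series for \<open>jsum y / (q / y; q)\<close> the substitution \<open>N = n + m\<close> turns the sum over \<open>m\<close> into Euler's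
    series for \<open>(q\<^bsup>n+1\<^esup>; q)\<close>, which vanishes for \<open>n < 0\<close>.\<close>
  define r where "r = (\<lambda>(n, m). (n + int m, m))"
  have r: "bij_betw r (UNIV \<times> UNIV) (UNIV \<times> UNIV)"
    by (rule bij_betwI[where g = "\<lambda>(n, m). (n - int m, m)"]) (auto simp: r_def)
  have tr: "t (r (n, m)) = jterm y n * (eul m * (q powi (n + 1)) ^ m)" for n m
  proof -
    have "(q powi (n + 1)) ^ m = q powi (n * int m) * q ^ m"
      by (simp add: power_int_power' algebra_simps power_int_add q_nz)
    then show ?thesis
      using y0 q_nz
      by (simp add: t_def r_def b_def jterm_def eul_eq tri_add power_int_add power_divide)
  qed
  have "((\<lambda>z. t (r z)) has_sum (jsum y * (\<Sum>m. b m))) (UNIV \<times> UNIV)"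
    using t has_sum_reindex_bij_betw[OF r] by blast
  moreover have "((\<lambda>m. t (r (n, m))) has_sum (jterm y n * qinf (q powi (n + 1)))) UNIV" for n
    unfolding tr by (rule has_sum_cmult_right, rule qinf_has_sum)
  ultimately have "((\<lambda>n. jterm y n * qinf (q powi (n + 1))) has_sum (jsum y * (\<Sum>m. b m))) UNIV"
    by (intro has_sum_SigmaD[where f = "\<lambda>z. t (r z)" and A = UNIV and B = "\<lambda>_. UNIV"]) auto
  then have "((\<lambda>n. jterm y n * qinf (q powi (n + 1))) has_sum (jsum y * (\<Sum>m. b m))) (range int)"
  proof (subst has_sum_cong_neutral[where S = "range int" and T = UNIV])
    fix n :: int assume "n \<in> UNIV - range int"
    then have "n < 0"
      by (metis DiffD2 int_nat_eq linorder_not_less rangeI)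
    then show "jterm y n * qinf (q powi (n + 1)) = 0"
      by (simp add: qinf_power_int_nonpos)
  qed auto
  then have "((\<lambda>n. jterm y (int n) * qinf (q powi (int n + 1))) has_sum (jsum y * (\<Sum>m. b m))) UNIV"
    by (subst (asm) has_sum_reindex) (auto simp: o_def)
  \<comment> \<open>For \<open>n \<ge> 0\<close> the factor \<open>qinf (q ^ Suc n)\<close> equals
    \<open>qinf q / qpoch q q n\<close>, which completes \<open>jterm\<close> to the term of Euler's
    series for \<open>qinf y\<close>.\<close>
  moreover have "jterm y (int n) * qinf (q powi (int n + 1)) = qinf q * (eul n * y ^ n)" for n
  proof -
    have "q powi (int n + 1) = q ^ Suc n"
      using power_int_of_nat[of q "Suc n"] by (simp only: of_nat_Suc add.commute)
    then show ?thesis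
      unfolding qinf_q_power \<open>q powi (int n + 1) = q ^ Suc n\<close> by (simp add: jterm_def eul_eq)
  qed
  ultimately have "((\<lambda>n. qinf q * (eul n * y ^ n)) has_sum (jsum y * (\<Sum>m. b m))) UNIV"
    by simp
  moreover have "((\<lambda>n. qinf q * (eul n * y ^ n)) has_sum (qinf q * qinf y)) UNIV"
    by (rule has_sum_cmult_right, rule qinf_has_sum)
  ultimately have "qinf q * qinf y = jsum y * (\<Sum>m. b m)"
    using has_sum_unique by blast
  then have "qinf q * thprod y = jsum y * ((\<Sum>m. b m) * qinf (q / y))"
    by (simp add: thprod_def)
  also have "\<dots> = jsum y"
    unfolding b_def using suminf_power_over_qpoch[OF qy] by simp
  finally show ?thesis .
qed

text \<open>Dividing \<open>y\<close> by a high power of \<open>q\<close> moves it into the range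
  already treated. Both sides have the same quasi-periodicity, so the identity carries back to
  \<open>y\<close>.\<close>

lemma triple_product:
  assumes y: "y \<noteq> 0"
  shows "qinf q * thprod y = jsum y"
proof -
  have "(\<lambda>n. norm q ^ Suc n) \<longlonglongrightarrow> 0"
    using LIMSEQ_power_zero[of "norm q"] q_lt_1 by (simp add: tendsto_mult_right_zero)
  then have "\<forall>\<^sub>F n in sequentially. norm q ^ Suc n < norm y"
    using y by (intro order_tendstoD) auto
  then obtain n where n: "norm q ^ Suc n < norm y"
    by (auto simp: eventually_sequentially)
  define w where "w = y * q powi (- int n)"
  have w: "w \<noteq> 0" and yw: "y = w * q powi int n"
    using y q_nz by (simp_all add: w_def power_int_minus)
  have "norm q < norm w"
    using n q_nz by (simp add: w_def norm_mult norm_divide norm_power power_int_minus_divide pos_less_divide_eq)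
  then have "qinf q * thprod w = jsum w"
    by (rule triple_product_annulus)
  moreover have "jsum y = (-1) powi int n * w powi (- int n) * q powi (- tri (int n)) * jsum w"
    unfolding yw by (rule quasi_periodic_iterate[OF jsum_step w])
  moreover have "thprod y = (-1) powi int n * w powi (- int n) * q powi (- tri (int n)) * thprod w"
    unfolding yw by (rule thprod_shift[OF w])
  ultimately show ?thesis by simp
qed

subsection \<open>The three-term relation\<close>

text \<open>Here \<open>\<epsilon>\<close> is the parity of the degree in \<open>a\<close>.
  Completing the square, \<open>n * n + n * \<epsilon>\<close> is the square of n + \<epsilon>/2 up
  to a constant: a theta series in a^2/x with characteristic \<epsilon>/2.\<close>

definition thterm :: "int \<Rightarrow> complex \<Rightarrow> complex \<Rightarrow> int \<Rightarrow> complex" where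
  "thterm \<epsilon> x a n = a powi (2 * n + \<epsilon>) * x powi (- n) * q powi (n * n + n * \<epsilon>)"

definition Th :: "int \<Rightarrow> complex \<Rightarrow> complex \<Rightarrow> complex" where
  "Th \<epsilon> x a = (\<Sum>\<^sub>\<infinity>n. thterm \<epsilon> x a n)"

definition hfun :: "complex \<Rightarrow> complex \<Rightarrow> complex \<Rightarrow> complex" where
  "hfun x a b = a * thprod (b / a) * thprod (x / (a * b))"

lemma thterm_summable:
  assumes "a \<noteq> 0" "x \<noteq> 0"
  shows "(\<lambda>n. norm (thterm \<epsilon> x a n)) summable_on UNIV"
proof -
  define R where "R = norm (a\<^sup>2 / x * q powi (1 + \<epsilon>))"
  have "norm (thterm \<epsilon> x a n) = norm a powi \<epsilon> * ((norm q ^ 2) powi tri n * R powi n)" for n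
  proof -
    have "n * n + n * \<epsilon> = 2 * tri n + (1 + \<epsilon>) * n"
      by (simp only: two_tri) (simp add: algebra_simps)
    then have "thterm \<epsilon> x a n = a powi \<epsilon> * (q powi (2 * tri n) * (a\<^sup>2 / x * q powi (1 + \<epsilon>)) powi n)"
      using assms q_nz unfolding thterm_def
      by (simp only: power_int_add power_int_mult power_int_mult_distrib power_int_divide_distrib simp_thms)
         (simp add: power_int_minus field_simps power_int_power)
    then show ?thesis
      unfolding R_def by (simp add: norm_mult norm_power_int norm_power norm_divide power_int_mult)
  qed
  moreover have "(\<lambda>n. norm a powi \<epsilon> * ((norm q ^ 2) powi tri n * R powi n)) summable_on UNIV"
    using assms q_nz q_lt_1 unfolding R_def
    by (intro summable_on_cmult_right summable_on_gauss) (auto simp: power_less_one_iff)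
  ultimately show ?thesis by simp
qed

text \<open>The triple product turns both theta factors into series. In the double series the
  exponents of \<open>a\<close> and \<open>b\<close> have opposite parity, so splitting by the
  parity of \<open>m + n\<close> separates the variables: each half is a product of a series in
  \<open>a\<close> and one in \<open>b\<close>.\<close>

lemma hfun_eq:
  assumes nz: "a \<noteq> 0" "b \<noteq> 0" "x \<noteq> 0"
  shows "(qinf q)\<^sup>2 * hfun x a b = Th 1 x a * Th 0 x b - Th 0 x a * Th 1 x b"
proof -
  define t where "t = (\<lambda>(m, n). a * (jterm (b / a) m * jterm (x / (a * b)) n))"
  have ba: "b / a \<noteq> 0" and xab: "x / (a * b) \<noteq> 0" using nz by auto
  have t_eq: "t (m, n) = (-1) powi (m + n) * a powi (1 - m - n) * b powi (m - n) * x powi n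
      * q powi (tri m + tri n)" for m n
    using nz q_nz
    by (simp add: t_def jterm_def power_int_add power_int_diff power_int_mult_distrib
        power_int_divide_distrib field_simps)
  have t: "(t has_sum (a * (jsum (b / a) * jsum (x / (a * b))))) UNIV"
    using has_sum_cmult_right[OF has_sum_times[OF jterm_summable[OF ba] jterm_summable[OF xab]], of a]
    by (simp add: t_def jsum_def case_prod_unfold)
  \<comment> \<open>\<open>f0\<close> and \<open>f1\<close> enumerate the pairs with even and odd sum.\<close>
  define f0 where "f0 = (\<lambda>(i, j). (j - i, - i - j) :: int \<times> int)"
  define f1 where "f1 = (\<lambda>(i, j). (j - i + 1, - i - j) :: int \<times> int)"
  have inj: "inj f0" "inj f1"
    by (auto simp: inj_def f0_def f1_def)
  have disj: "range f0 \<inter> range f1 = {}"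
    by (auto simp: f0_def f1_def) presburger
  have un: "range f0 \<union> range f1 = UNIV"
  proof -
    have "(m, n) \<in> range f0 \<union> range f1" for m n :: int
    proof (cases "even (m + n)")
      case True
      then obtain k where "m + n = 2 * k" by (elim evenE)
      then have "(m, n) = f0 (- k, m - k)" by (simp add: f0_def)
      then show ?thesis by (metis UnI1 rangeI)
    next
      case False
      then obtain k where "m + n = 2 * k + 1" by (elim oddE)
      then have "(m, n) = f1 (- k, m - 1 - k)" by (simp add: f1_def)
      then show ?thesis by (metis UnI2 rangeI)
    qed
    then show ?thesis by auto
  qed
  have sgn: "(-1 :: complex) powi (k + k) = 1" for k
    by (simp add: power_int_add)
  have t0: "t (f0 (i, j)) = thterm 1 x a i * thterm 0 x b j" for i j
  proof -
    have "2 * (tri (j - i) + tri (- i - j)) = 2 * (i * i + i + j * j)"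
      by (simp only: two_tri distrib_left) (simp add: algebra_simps)
    then have e: "tri (j - i) + tri (- i - j) = (i * i + i) + j * j" by simp
    \<comment> \<open>The total sign exponent is written as \<open>k + k\<close> so that
      \<open>sgn\<close> removes it.\<close>
    have s: "j - i + (- i - j) = (-i) + (-i)" "1 - (j - i) - (- i - j) = 2 * i + 1"
      "j - i - (- i - j) = 2 * j" "- i - j = (-i) + (-j)"
      by simp_all
    show ?thesis
      unfolding f0_def prod.case t_eq e s(1-3) sgn unfolding thterm_def s(4) using nz q_nz
      by (simp add: power_int_add power_int_diff power_int_minus_divide)
  qed
  have t1: "t (f1 (i, j)) = - (thterm 0 x a i * thterm 1 x b j)" for i j
  proof -
    have "2 * (tri (j - i + 1) + tri (- i - j)) = 2 * (i * i + j * j + j)"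
      by (simp only: two_tri distrib_left) (simp add: algebra_simps)
    then have e: "tri (j - i + 1) + tri (- i - j) = i * i + (j * j + j)" by simp
    have s: "j - i + 1 + (- i - j) = 1 + ((-i) + (-i))" "1 - (j - i + 1) - (- i - j) = 2 * i"
      "j - i + 1 - (- i - j) = 2 * j + 1" "- i - j = (-i) + (-j)"
      by simp_all
    show ?thesis
      unfolding f1_def prod.case t_eq e s(1-3) power_int_neg_one_add[of 1] sgn
      unfolding thterm_def s(4) using nz q_nz
      by (simp add: power_int_add power_int_diff power_int_minus_divide)
  qed
  have "((t \<circ> f0) has_sum (Th 1 x a * Th 0 x b)) UNIV"
    using has_sum_times[OF thterm_summable[of a x 1] thterm_summable[of b x 0]] nz
    by (simp add: Th_def o_def t0 case_prod_unfold flip: t0)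
  then have 0: "(t has_sum (Th 1 x a * Th 0 x b)) (range f0)"
    using has_sum_reindex[OF inj(1)] by blast
  have "((t \<circ> f1) has_sum (- (Th 0 x a * Th 1 x b))) UNIV"
    using has_sum_uminusI[OF has_sum_times[OF thterm_summable[of a x 0] thterm_summable[of b x 1]]] nz
    by (simp add: Th_def o_def t1 case_prod_unfold flip: t1)
  then have 1: "(t has_sum (- (Th 0 x a * Th 1 x b))) (range f1)"
    using has_sum_reindex[OF inj(2)] by blast
  have "a * (jsum (b / a) * jsum (x / (a * b))) = Th 1 x a * Th 0 x b + - (Th 0 x a * Th 1 x b)"
    using has_sum_Un_disjoint[OF 0 1 disj] t unfolding un by (rule has_sum_unique[rotated])
  then show ?thesis
    by (simp add: hfun_def power2_eq_square mult_ac flip: triple_product[OF ba] triple_product[OF xab])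
qed

definition Phi :: "complex \<Rightarrow> complex \<Rightarrow> complex \<Rightarrow> complex" where
  "Phi c x a = (\<Sum>\<^sub>\<infinity>n::int. qinf (c * a * q powi n) * qinf (q powi (1 - n) / a)
     * (a powi (2 * n) * x powi (- n) * q powi (n * n)))"

text \<open>The \<open>n\<close>-th term of \<open>Phi\<close> with both infinite products expanded
  by Euler's identity; \<open>k\<close> belongs to the first product and \<open>l\<close> to the
  second.\<close>

definition Phi_term :: "complex \<Rightarrow> complex \<Rightarrow> complex \<Rightarrow> int \<Rightarrow> nat \<times> nat \<Rightarrow> complex" where
  "Phi_term c x a n = (\<lambda>(k, l). eul k * (c * a * q powi n) ^ k * (eul l * (q powi (1 - n) / a) ^ l)
     * (a powi (2 * n) * x powi (- n) * q powi (n * n)))"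

lemma Phi_term_summable:
  assumes nz: "a \<noteq> 0" "c \<noteq> 0" "x \<noteq> 0"
  shows "(\<lambda>(n, kl). Phi_term c x a n kl) summable_on (UNIV \<times> UNIV)"
proof -
  obtain B where B: "B > 0" "\<And>n. norm (1 / qpoch q q n) \<le> B"
    using inverse_qpoch_q_bounded by blast
  \<comment> \<open>This is the factor left over for each unit of \<open>n\<close> once
    \<open>k\<close> and \<open>l\<close> have been replaced by \<open>p = n + k\<close> and
    \<open>r = l - n\<close>.\<close>
  define w where "w = norm (q / (c * x))"
  define W where "W = max w (1 / w)"
  have w0: "w > 0" using nz q_nz by (simp add: w_def)
  have W1: "W \<ge> 1" using w0 by (cases "w \<ge> 1") (auto simp: W_def le_max_iff_disj)
  \<comment> \<open>The 2 in \<open>2 * W\<close> pays for the geometric factor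
    \<open>(1/2) ^ nat \<bar>n\<bar>\<close> in \<open>G\<close>, which makes the sum over
    \<open>n\<close> converge.\<close>
  define F1 where "F1 = (\<lambda>p. norm q powi tri p * norm (c * a) powi p * (2 * W) ^ nat \<bar>p\<bar>)"
  define F2 where "F2 = (\<lambda>p. norm q powi tri p * norm (q / a) powi p * (2 * W) ^ nat \<bar>p\<bar>)"
  define G where "G = (\<lambda>(n, p, r). (1/2 :: real) ^ nat \<bar>n\<bar> * (F1 p * F2 r))"
  have F: "F1 summable_on UNIV" "F2 summable_on UNIV"
    unfolding F1_def F2_def using nz q_nz q_lt_1 W1 by (intro summable_on_gauss_abs; auto)+
  have Fpos: "F1 p \<ge> 0" "F2 p \<ge> 0" for p
    using W1 by (auto simp: F1_def F2_def)
  have "G summable_on (UNIV \<times> (UNIV \<times> UNIV))"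
    using summable_on_times_nonneg[OF summable_on_geometric_abs summable_on_times_nonneg[OF F]] Fpos
    unfolding G_def by (simp add: case_prod_unfold)
  \<comment> \<open>The exponent of \<open>q\<close> is a degenerate quadratic form in \<open>(n, k, l)\<close>, but it is \<open>tri p + tri r\<close> up to a linear
    term in \<open>p = n + k\<close>, \<open>r = l - n\<close> and \<open>n\<close>, and \<open>k, l \<ge> 0\<close> forces \<open>\<bar>n\<bar> \<le> \<bar>p\<bar> + \<bar>r\<bar>\<close>.\<close>
  define g where "g = (\<lambda>(n, k, l). (n, n + int k, int l - n))"
  have inj: "inj g" by (auto simp: inj_def g_def)
  have "G summable_on range g"
    by (rule summable_on_subset_banach[OF \<open>G summable_on _\<close>]) auto
  then have "(G \<circ> g) summable_on UNIV"
    using summable_on_reindex[OF inj, of G] by blast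
  then have Gg: "(\<lambda>z. B * B * G (g z)) summable_on UNIV"
    by (intro summable_on_cmult_right) (simp add: o_def)
  have bound: "norm (Phi_term c x a n (k, l)) \<le> B * B * G (g (n, k, l))" for n k l
  proof -
    define p where "p = n + int k"
    define r where "r = int l - n"
    have e1: "norm (eul k) * norm (eul l) \<le> (B * norm q powi tri (int k)) * (B * norm q powi tri (int l))"
      using norm_eul_le[OF B(2)] B(1) by (intro mult_mono) auto
    have tp: "tri p + tri r = tri (int k) + tri (int l) + n * n + n * int k - n * int l"
    proof -
      have "2 * (tri p + tri r) = 2 * (tri (int k) + tri (int l) + n * n + n * int k - n * int l)"
        by (simp only: two_tri distrib_left right_diff_distrib p_def r_def) (simp add: algebra_simps)
      then show ?thesis by simp
    qed
    define M where "M = norm (c * a * q powi n) ^ k * norm (q powi (1 - n) / a) ^ l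
        * (norm a powi (2 * n) * norm x powi (- n) * norm q powi (n * n))"
    have M: "norm q powi tri (int k) * norm q powi tri (int l) * M
        = norm q powi (tri p + tri r) * norm (c * a) powi p * norm (q / a) powi r * w powi n"
    proof -
      have p1: "norm (c * a * q powi n) ^ k = norm (c * a) ^ k * norm q powi (n * int k)"
        by (simp add: norm_mult norm_power_int power_mult_distrib power_int_power')
      have p2: "norm (q powi (1 - n) / a) ^ l = norm (q / a) ^ l * norm q powi (- n * int l)"
        using q_nz by (simp add: norm_divide norm_power_int power_divide power_int_diff_power)
      have p3: "norm (c * a) powi p = norm (c * a) ^ k * norm (c * a) powi n"
        using nz by (simp add: p_def power_int_add)
      have p4: "norm (q / a) powi r = norm (q / a) ^ l * norm (q / a) powi (- n)"
        using nz q_nz by (simp add: r_def power_int_diff power_int_minus field_simps)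
      have p5: "norm a powi (2 * n) * norm x powi (- n)
          = norm (c * a) powi n * norm (q / a) powi (- n) * w powi n"
        using nz q_nz unfolding w_def
        by (simp add: norm_mult norm_divide power_int_mult_distrib power_int_divide_distrib power_int_minus
            field_simps power_int_mult power2_eq_square)
      have p6: "norm q powi (tri p + tri r) = norm q powi tri (int k) * norm q powi tri (int l)
          * norm q powi (n * n) * norm q powi (n * int k) * norm q powi (- n * int l)"
        unfolding tp using q_nz by (simp add: power_int_add power_int_diff power_int_minus field_simps)
      show ?thesis
        unfolding M_def p1 p2 p3 p4 p6 p5 by (simp only: mult_ac)
    qed
    have wn: "w powi n \<le> (1/2) ^ nat \<bar>n\<bar> * ((2 * W) ^ nat \<bar>p\<bar> * (2 * W) ^ nat \<bar>r\<bar>)"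
    proof -
      have "w powi n \<le> W ^ nat \<bar>n\<bar>"
        unfolding W_def by (rule power_int_abs_le[OF w0])
      also have "\<dots> = (1/2) ^ nat \<bar>n\<bar> * (2 * W) ^ nat \<bar>n\<bar>"
        by (simp add: power_mult_distrib power_one_over)
      also have "\<dots> \<le> (1/2) ^ nat \<bar>n\<bar> * (2 * W) ^ (nat \<bar>p\<bar> + nat \<bar>r\<bar>)"
        using W1 by (intro mult_left_mono power_increasing) (auto simp: p_def r_def)
      finally show ?thesis by (simp add: power_add)
    qed
    have M0: "M \<ge> 0" by (simp add: M_def)
    have "norm (Phi_term c x a n (k, l)) = norm (eul k) * norm (eul l) * M"
      by (simp add: Phi_term_def norm_mult norm_power norm_power_int M_def)
    also have "\<dots> \<le> (B * norm q powi tri (int k)) * (B * norm q powi tri (int l)) * M"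
      using e1 M0 by (rule mult_right_mono)
    also have "\<dots> = B * B * (norm q powi tri (int k) * norm q powi tri (int l) * M)"
      by (simp only: mult_ac)
    also have "\<dots> = B * B * (norm q powi (tri p + tri r) * norm (c * a) powi p * norm (q / a) powi r * w powi n)"
      by (simp only: M)
    also have "\<dots> \<le> B * B * (norm q powi (tri p + tri r) * norm (c * a) powi p * norm (q / a) powi r *
        ((1/2) ^ nat \<bar>n\<bar> * ((2 * W) ^ nat \<bar>p\<bar> * (2 * W) ^ nat \<bar>r\<bar>)))"
      using wn B(1) by (intro mult_left_mono) auto
    also have "\<dots> = B * B * G (g (n, k, l))"
      using q_nz by (simp add: G_def g_def F1_def F2_def p_def r_def power_int_add mult_ac)
    finally show ?thesis .
  qed
  have "(\<lambda>z. norm (case z of (n, kl) \<Rightarrow> Phi_term c x a n kl)) summable_on UNIV"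
  proof (rule summable_on_comparison_test[OF Gg])
    fix z :: "int \<times> nat \<times> nat"
    show "norm (case z of (n, kl) \<Rightarrow> Phi_term c x a n kl) \<le> B * B * G (g z)"
      using bound by (cases z) auto
  qed auto
  from abs_summable_summable[OF this] show ?thesis by simp
qed

lemma Phi_term_infsum:
  "(\<Sum>\<^sub>\<infinity>kl. Phi_term c x a n kl) = qinf (c * a * q powi n) * qinf (q powi (1 - n) / a)
     * (a powi (2 * n) * x powi (- n) * q powi (n * n))"
proof -
  have s: "(\<lambda>k. norm (eul k * y ^ k)) summable_on UNIV" for y
    using summable_norm_eul[of y] by (intro norm_summable_imp_summable_on) simp
  have i: "(\<Sum>\<^sub>\<infinity>k. eul k * y ^ k) = qinf y" for y
    by (rule infsumI) (rule qinf_has_sum)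
  have "((\<lambda>(k, l). (eul k * (c * a * q powi n) ^ k) * (eul l * (q powi (1 - n) / a) ^ l))
      has_sum (qinf (c * a * q powi n) * qinf (q powi (1 - n) / a))) (UNIV \<times> UNIV)"
    using has_sum_times[OF s s, of "c * a * q powi n" "q powi (1 - n) / a"] unfolding i .
  from has_sum_cmult_left[OF this, of "a powi (2 * n) * x powi (- n) * q powi (n * n)"]
  show ?thesis
    by (intro infsumI) (simp add: Phi_term_def case_prod_unfold)
qed

text \<open>The total degree in \<open>a\<close> is \<open>2 * n + d\<close>. Writing
  \<open>d = 2 * e + \<epsilon>\<close> and shifting \<open>n\<close> by \<open>e\<close> leaves a
  theta series times a constant free of \<open>a\<close>, so \<open>a\<close> sees only the parity
  of \<open>d\<close>.\<close>

lemma Phi_term_infsum_swapped: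
  fixes k l :: nat
  assumes nz: "a \<noteq> 0" "c \<noteq> 0" "x \<noteq> 0"
  defines "d \<equiv> int k - int l"
  shows "(\<Sum>\<^sub>\<infinity>n. Phi_term c x a n (k, l)) = eul k * eul l * c ^ k * q ^ l * x powi (d div 2)
     * q powi (- ((d div 2) * (d div 2) + (d div 2) * (d mod 2))) * Th (d mod 2) x a"
proof -
  define e where "e = d div 2"
  define \<epsilon> where "\<epsilon> = d mod 2"
  define C where "C = eul k * eul l * c ^ k * q ^ l * x powi e * q powi (- (e * e + e * \<epsilon>))"
  have d: "d = 2 * e + \<epsilon>" by (simp add: e_def \<epsilon>_def)
  have "Phi_term c x a n (k, l) = C * thterm \<epsilon> x a (n + e)" for n
  proof -
    have p1: "(q powi n) ^ k = q powi (n * int k)"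
      by (simp add: power_int_power')
    have p2: "(q powi (1 - n)) ^ l = q ^ l * q powi (- n * int l)"
      by (rule power_int_diff_power[OF q_nz])
    have p3: "a ^ k * (1 / a) ^ l = a powi d"
      using nz by (simp add: d_def power_int_diff power_divide)
    have p4: "q powi (n * int k) * q powi (- n * int l) = q powi (n * d)"
      using q_nz by (simp add: d_def power_int_diff power_int_minus field_simps)
    have "Phi_term c x a n (k, l) = eul k * eul l * c ^ k * q ^ l * (a ^ k * (1 / a) ^ l) * a powi (2 * n)
        * x powi (- n) * q powi (n * n) * (q powi (n * int k) * q powi (- n * int l))"
      by (simp add: Phi_term_def power_mult_distrib power_divide p1 p2)
    also have "\<dots> = eul k * eul l * c ^ k * q ^ l * a powi d * a powi (2 * n)
        * x powi (- n) * q powi (n * n) * q powi (n * d)"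
      by (simp only: p3 p4)
    also have "\<dots> = C * thterm \<epsilon> x a (n + e)"
    proof -
      have m1: "a powi d * a powi (2 * n) = a powi (2 * (n + e) + \<epsilon>)"
        using nz by (simp add: d algebra_simps flip: power_int_add)
      have m2: "x powi (- n) = x powi e * x powi (- (n + e))"
        using nz by (simp flip: power_int_add)
      have m3: "q powi (n * n) * q powi (n * d)
          = q powi (- (e * e + e * \<epsilon>)) * q powi ((n + e) * (n + e) + (n + e) * \<epsilon>)"
        using q_nz by (simp add: d algebra_simps flip: power_int_add)
      have "eul k * eul l * c ^ k * q ^ l * a powi d * a powi (2 * n) * x powi (- n) * q powi (n * n) * q powi (n * d)
          = (eul k * eul l * c ^ k * q ^ l) * (a powi d * a powi (2 * n)) * x powi (- n)
            * (q powi (n * n) * q powi (n * d))"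
        by (simp only: mult_ac)
      also have "\<dots> = C * thterm \<epsilon> x a (n + e)"
        unfolding m1 m2 m3 C_def thterm_def by (simp only: mult_ac)
      finally show ?thesis .
    qed
    finally show ?thesis .
  qed
  then have "(\<Sum>\<^sub>\<infinity>n. Phi_term c x a n (k, l)) = C * (\<Sum>\<^sub>\<infinity>n. thterm \<epsilon> x a (n + e))"
    by (simp add: infsum_cmult_right')
  also have "\<dots> = C * Th \<epsilon> x a"
    unfolding Th_def by (simp only: infsum_int_shift[of "thterm \<epsilon> x a"])
  finally show ?thesis by (simp add: C_def e_def \<epsilon>_def)
qed

text \<open>Absolute convergence allows summing over \<open>n\<close> first, so it suffices to treat
  fixed \<open>(k, l)\<close>, where \<open>Phi\<close> is replaced by a multiple of
  \<open>Th \<epsilon>\<close>. As \<open>hfun\<close> is a 2 by 2 determinant in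
  \<open>Th 1\<close> and \<open>Th 0\<close>, the cyclic sum expands a 3 by 3 determinant with two
  equal rows.\<close>

lemma Phi_three_term:
  assumes nz: "a \<noteq> 0" "b \<noteq> 0" "s \<noteq> 0" "c \<noteq> 0" "x \<noteq> 0"
  shows "Phi c x a * hfun x b s + Phi c x b * hfun x s a + Phi c x s * hfun x a b = 0"
proof -
  define T where "T = (\<lambda>a kl. \<Sum>\<^sub>\<infinity>n. Phi_term c x a n kl)"
  have Phi: "(T a has_sum Phi c x a) UNIV" if "a \<noteq> 0" for a
  proof -
    have s: "(\<lambda>(n, kl). Phi_term c x a n kl) summable_on (UNIV \<times> UNIV)"
      by (rule Phi_term_summable) (use that nz in auto)
    then have "(\<lambda>(kl, n). Phi_term c x a n kl) summable_on (UNIV \<times> UNIV)"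
      by (subst summable_on_swap) (simp add: case_prod_unfold)
    then have "T a summable_on UNIV"
      unfolding T_def by (rule summable_on_Sigma_banach)
    moreover have "Phi c x a = infsum (T a) UNIV"
      unfolding Phi_def T_def Phi_term_infsum[symmetric]
      by (rule infsum_swap_banach[OF s])
    ultimately show ?thesis by (simp add: has_sum_iff)
  qed
  have "T a kl * hfun x b s + T b kl * hfun x s a + T s kl * hfun x a b = 0" for kl
  proof -
    obtain k l where kl: "kl = (k, l)" by force
    define \<epsilon> where "\<epsilon> = (int k - int l) mod 2"
    \<comment> \<open>The same constant serves for \<open>a\<close>, \<open>b\<close> and
      \<open>s\<close>, which is what lets it factor out.\<close>
    obtain C where C: "\<And>a. a \<noteq> 0 \<Longrightarrow> T a kl = C * Th \<epsilon> x a"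
      unfolding T_def kl \<epsilon>_def using Phi_term_infsum_swapped[OF _ nz(4,5)] by blast
    have "\<epsilon> = 0 \<or> \<epsilon> = 1"
      unfolding \<epsilon>_def by presburger
    then have "(qinf q)\<^sup>2 * (T a kl * hfun x b s + T b kl * hfun x s a + T s kl * hfun x a b)
      = C * (Th \<epsilon> x a * ((qinf q)\<^sup>2 * hfun x b s) + Th \<epsilon> x b * ((qinf q)\<^sup>2 * hfun x s a)
          + Th \<epsilon> x s * ((qinf q)\<^sup>2 * hfun x a b))"
      using nz by (simp add: C algebra_simps)
    also have "\<dots> = 0"
      unfolding hfun_eq[OF nz(2,3,5)] hfun_eq[OF nz(3,1,5)] hfun_eq[OF nz(1,2,5)]
      using \<open>\<epsilon> = 0 \<or> \<epsilon> = 1\<close> by (auto simp: algebra_simps)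
    finally show ?thesis by simp
  qed
  moreover have "((\<lambda>kl. T a kl * hfun x b s + T b kl * hfun x s a + T s kl * hfun x a b) has_sum
      (Phi c x a * hfun x b s + Phi c x b * hfun x s a + Phi c x s * hfun x a b)) UNIV"
    using nz by (intro has_sum_add has_sum_cmult_left Phi)
  ultimately show ?thesis
    using has_sum_unique[OF _ has_sum_0] by (metis (no_types, lifting) has_sum_cong has_sum_0)
qed

subsection \<open>The one-dimensional identity\<close>

lemma Phi_has_sum:
  assumes nz: "a \<noteq> 0" "c \<noteq> 0" "x \<noteq> 0"
  shows "((\<lambda>n::int. qinf (c * a * q powi n) * qinf (q powi (1 - n) / a)
     * (a powi (2 * n) * x powi (- n) * q powi (n * n))) has_sum Phi c x a) UNIV"
  using summable_on_Sigma_banach[OF Phi_term_summable[OF nz]]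
  unfolding Phi_term_infsum Phi_def by (rule has_sum_infsum)

lemma power_int_neg_Suc: "q powi (- int (Suc k)) = 1 / (q * q ^ k)"
  by (simp only: power_int_minus_divide power_int_of_nat power_Suc)

text \<open>The factors are 1 - c q^(-j) = -c q^(-j) (1 - q^j / c) for 1 \<le> j \<le> k, and these
  j add up to \<open>tri (int k) + int k\<close>.\<close>

lemma qpoch_reflect:
  assumes "c \<noteq> 0"
  shows "qpoch (c * q powi (- int k)) q k
    = (-1) ^ k * c ^ k * q powi (- (tri (int k) + int k)) * qpoch (q / c) q k"
proof (induction k)
  case (Suc k)
  have "c * q powi (- int (Suc k)) * q = c * q powi (- int k)"
    unfolding power_int_neg_Suc using q_nz by (simp add: power_int_minus field_simps)
  then have "qpoch (c * q powi (- int (Suc k))) q (Suc k)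
      = (1 - c * q powi (- int (Suc k))) * qpoch (c * q powi (- int k)) q k"
    by (simp only: qpoch_Suc_shift)
  also have "1 - c * q powi (- int (Suc k)) = - c * q powi (- int (Suc k)) * (1 - q / c * q ^ k)"
    unfolding power_int_neg_Suc using assms q_nz by (simp add: field_simps)
  also have "qpoch (c * q powi (- int k)) q k
    = (-1) ^ k * c ^ k * q powi (- (tri (int k) + int k)) * qpoch (q / c) q k"
    by (rule Suc)
  also have "- c * q powi (- int (Suc k)) * (1 - q / c * q ^ k)
      * ((-1) ^ k * c ^ k * q powi (- (tri (int k) + int k)) * qpoch (q / c) q k)
    = (-1) ^ Suc k * c ^ Suc k * (q powi (- int (Suc k)) * q powi (- (tri (int k) + int k)))
      * qpoch (q / c) q (Suc k)"
    by (simp add: qpoch_Suc)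
  also have "q powi (- int (Suc k)) * q powi (- (tri (int k) + int k))
      = q powi (- (tri (int (Suc k)) + int (Suc k)))"
  proof -
    have "tri (int (Suc k)) = tri (int k) + int k"
      by (simp add: tri_add add.commute[of 1])
    then have "- (tri (int (Suc k)) + int (Suc k)) = - int (Suc k) + - (tri (int k) + int k)"
      by simp
    then show ?thesis
      using q_nz by (simp only: power_int_add simp_thms)
  qed
  finally show ?case .
qed simp

lemma Phi_1:
  assumes nz: "c \<noteq> 0" "x \<noteq> 0"
  shows "Phi c x 1 = qinf c * qinf q * phi11 (q / c) q (c * x)"
proof -
  define s where "s = (\<lambda>n::int. qinf (c * 1 * q powi n) * qinf (q powi (1 - n) / 1)
     * (1 powi (2 * n) * x powi (- n) * q powi (n * n)))"
  define p where "p = (\<lambda>k. qpoch (q / c) q k / qpoch q q k * (-1) ^ k * q ^ (k * (k - 1) div 2) * (c * x) ^ k)"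
  have "(s has_sum Phi c x 1) UNIV"
    unfolding s_def by (rule Phi_has_sum) (use nz in auto)
  then have "(s has_sum Phi c x 1) (range (\<lambda>k. - int k))"
  proof (subst has_sum_cong_neutral[where S = "range (\<lambda>k. - int k)" and T = UNIV])
    fix n :: int assume "n \<in> UNIV - range (\<lambda>k. - int k)"
    then have "n > 0"
      by (metis DiffD2 int_nat_eq linorder_not_less minus_minus neg_0_le_iff_le rangeI)
    then show "s n = 0"
      by (simp add: s_def qinf_power_int_nonpos)
  qed auto
  then have "((\<lambda>k. s (- int k)) has_sum Phi c x 1) UNIV"
    by (subst (asm) has_sum_reindex) (auto simp: o_def inj_def)
  moreover have "s (- int k) = qinf c * qinf q * p k" for k
  proof -
    have 1: "qinf (c * q powi (- int k)) = qpoch (c * q powi (- int k)) q k * qinf c"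
      using qinf_shift[of "c * q powi (- int k)" k] q_nz by (simp add: power_int_minus mult.assoc)
    have "q powi (1 + int k) = q ^ Suc k"
      using power_int_of_nat[of q "Suc k"] by (simp only: of_nat_Suc)
    then have 2: "qinf (q powi (1 + int k)) = qinf q / qpoch q q k"
      using qinf_q_power[of k] by simp
    have "2 * (- (tri (int k) + int k) + int k * int k) = 2 * tri (int k)"
      by (simp only: two_tri distrib_left mult_minus_right) (simp add: algebra_simps)
    then have "- (tri (int k) + int k) + int k * int k = tri (int k)" by simp
    then have "q powi (- (tri (int k) + int k)) * q powi (int k * int k) = q powi tri (int k)"
      using q_nz by (metis power_int_add)
    then have 3: "q powi (- (tri (int k) + int k)) * q powi (int k * int k) = q ^ (k * (k - 1) div 2)"
      by (simp only: tri_of_nat power_int_of_nat)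
    have "s (- int k) = qinf c * (qinf q / qpoch q q k) * ((-1) ^ k * c ^ k * qpoch (q / c) q k) * x ^ k
        * (q powi (- (tri (int k) + int k)) * q powi (int k * int k))"
      by (simp add: s_def 1 2 qpoch_reflect[OF nz(1)])
    then show ?thesis
      unfolding 3 by (simp add: p_def power_mult_distrib)
  qed
  ultimately have "((\<lambda>k. qinf c * qinf q * p k) has_sum Phi c x 1) UNIV"
    by simp
  then have "(\<lambda>k. qinf c * qinf q * p k) sums Phi c x 1"
    by (rule has_sum_imp_sums)
  \<comment> \<open>Summability of \<open>p\<close> is obtained by dividing by
    \<open>qinf c * qinf q\<close>. If \<open>qinf c = 0\<close>, both sides vanish whatever the
    value of \<open>phi11\<close>.\<close>
  show ?thesis
  proof (cases "qinf c = 0")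
    case True
    then have "(\<lambda>k. 0) sums Phi c x 1"
      using \<open>(\<lambda>k. qinf c * qinf q * p k) sums Phi c x 1\<close> by simp
    then show ?thesis
      using sums_unique2[OF _ sums_zero] True by simp
  next
    case False
    have "(\<lambda>k. qinf c * qinf q * p k / (qinf c * qinf q)) sums (Phi c x 1 / (qinf c * qinf q))"
      by (rule sums_divide) fact
    then have "p sums (Phi c x 1 / (qinf c * qinf q))"
      using False by simp
    then have "phi11 (q / c) q (c * x) = Phi c x 1 / (qinf c * qinf q)"
      unfolding phi11_def p_def by (simp add: sums_iff)
    then show ?thesis using False by simp
  qed
qed

section \<open>The one-index series, its difference and its growth\<close>

definition qratio :: "complex \<Rightarrow> complex \<Rightarrow> complex" where
  "qratio c y = qinf (c * y) / qinf y"

text \<open>The sum over the first index in \<open>mu_hat\<close> without its theta denominator,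
  with \<open>a\<close> = e(u_0) and \<open>a / x\<close> = e(-u_1). The parameter \<open>x\<close>
  = e(u_0 + u_1) is unchanged when z is moved from u_0 to u_1.\<close>

definition Dser :: "complex \<Rightarrow> complex \<Rightarrow> complex \<Rightarrow> complex" where
  "Dser c x a = (\<Sum>\<^sub>\<infinity>n. qratio c (a * q powi n) * ((-1) powi n * (a / x) powi n * q powi (tri n + n)))"

lemma thprod_nz:
  assumes "y \<noteq> 0" "\<And>n::int. y * q powi n \<noteq> 1"
  shows "thprod y \<noteq> 0"
proof -
  have "y * q ^ n \<noteq> 1" for n
    using assms(2)[of "int n"] by simp
  moreover have "q / y * q ^ n \<noteq> 1" for n
    using assms(2)[of "- int n - 1"] assms(1) q_nz
    by (auto simp: power_int_diff power_int_minus field_simps)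
  ultimately show ?thesis
    unfolding thprod_def using qinf_nz by simp
qed

text \<open>In the \<open>n\<close>-th term quasi-periodicity rewrites \<open>thprod a\<close>
  through \<open>thprod (a * q powi n)\<close>, whose factor \<open>qinf (a * q powi n)\<close>
  cancels the denominator of \<open>qratio\<close>.\<close>

lemma Dser_eq_Phi:
  assumes nz: "a \<noteq> 0" "x \<noteq> 0" and P: "thprod a \<noteq> 0"
  shows "Dser c x a * thprod a = Phi c x a"
proof -
  have "qratio c (a * q powi n) * ((-1) powi n * (a / x) powi n * q powi (tri n + n)) * thprod a
      = qinf (c * a * q powi n) * qinf (q powi (1 - n) / a)
        * (a powi (2 * n) * x powi (- n) * q powi (n * n))" for n
  proof -
    define y where "y = a * q powi n"
    define y' where "y' = qinf (q powi (1 - n) / a)"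
    have "q / y = q powi (1 - n) / a"
      using nz q_nz by (simp add: y_def power_int_diff)
    then have Py: "thprod y = qinf y * y'"
      by (simp add: thprod_def y'_def)
    have sh: "thprod y = (-1) powi n * a powi (-n) * q powi (- tri n) * thprod a"
      unfolding y_def by (rule thprod_shift) (rule nz)
    then have "thprod y \<noteq> 0" using P nz q_nz by simp
    then have "qinf y \<noteq> 0" by (simp add: Py)
    have "(-1) powi n * a powi n * q powi (tri n) * thprod y
        = ((-1) powi n * (-1) powi n) * (a powi n * a powi (-n)) * (q powi tri n * q powi (- tri n)) * thprod a"
      unfolding sh by (simp only: mult_ac)
    then have Pa: "thprod a = (-1) powi n * a powi n * q powi (tri n) * (qinf y * y')"
      using nz q_nz by (simp add: Py power_int_minus)
    have n: "n * n = tri n + (tri n + n)"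
      using two_tri[of n] by (simp add: algebra_simps)
    have "qratio c y * ((-1) powi n * (a / x) powi n * q powi (tri n + n)) * thprod a
      = ((-1) powi n * (-1) powi n) * (qinf (c * y) * y' * (qinf y / qinf y)) * (a powi n * (a / x) powi n)
        * (q powi (tri n) * q powi (tri n + n))"
      unfolding Pa qratio_def by (simp only: mult_ac times_divide_eq_right times_divide_eq_left)
    also have "\<dots> = qinf (c * y) * y' * (a powi (2 * n) * x powi (- n) * q powi (n * n))"
      unfolding n using \<open>qinf y \<noteq> 0\<close> nz q_nz
      by (simp add: power_int_add power_int_divide_distrib power_int_minus field_simps power_int_mult power2_eq_square)
    finally show ?thesis by (simp add: y_def y'_def mult.assoc)
  qed
  then show ?thesis
    unfolding Dser_def Phi_def by (simp add: infsum_cmult_left'[symmetric])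
qed

text \<open>The three-term relation at \<open>s = 1\<close>, divided by
  \<open>thprod a * thprod b\<close>. The reflection of \<open>thprod (1 / b)\<close> produces the
  minus sign of the difference.\<close>

lemma Dser_difference:
  assumes nz: "a \<noteq> 0" "b \<noteq> 0" "c \<noteq> 0" "x \<noteq> 0" and P: "thprod a \<noteq> 0" "thprod b \<noteq> 0"
  shows "Dser c x a * thprod (x / b) - Dser c x b * thprod (x / a)
    = qinf c * qinf q * phi11 (q / c) q (c * x) * (a * thprod (b / a) * thprod (x / (a * b)) / (thprod a * thprod b))"
proof -
  have "Phi c x a * hfun x b 1 + Phi c x b * hfun x 1 a + Phi c x 1 * hfun x a b = 0"
    by (rule Phi_three_term) (use nz in auto)
  moreover have "hfun x b 1 = - (thprod b * thprod (x / b))"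
    using nz by (simp add: hfun_def thprod_inverse)
  moreover have "hfun x 1 a = thprod a * thprod (x / a)"
    by (simp add: hfun_def)
  ultimately have "thprod a * thprod b * (Dser c x a * thprod (x / b) - Dser c x b * thprod (x / a)) = Phi c x 1 * hfun x a b"
    unfolding Dser_eq_Phi[OF nz(1,4) P(1), symmetric] Dser_eq_Phi[OF nz(2,4) P(2), symmetric]
    by (simp add: algebra_simps)
  then show ?thesis
    unfolding Phi_1[OF nz(3,4)] hfun_def using P by (simp add: divide_simps mult_ac)
qed

text \<open>Scaling \<open>a\<close>, \<open>b\<close>, \<open>x\<close> by \<open>q powi m\<close>
  fixes \<open>b / a\<close>, \<open>x / a\<close> and \<open>x / b\<close>. Only
  \<open>thprod\<close> at \<open>a\<close>, \<open>b\<close> and \<open>x / (a * b)\<close> is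
  shifted, the last in the opposite direction.\<close>

lemma Dser_difference_shifted:
  assumes nz: "a \<noteq> 0" "b \<noteq> 0" "c \<noteq> 0" "x \<noteq> 0" and P: "thprod a \<noteq> 0" "thprod b \<noteq> 0"
  shows "Dser c (x * q powi m) (a * q powi m) * thprod (x / b) - Dser c (x * q powi m) (b * q powi m) * thprod (x / a)
    = qinf c * qinf q * phi11 (q / c) q (c * x * q powi m) * ((-1) powi m * x powi m * q powi tri m)
      * (a * thprod (b / a) * thprod (x / (a * b)) / (thprod a * thprod b))"
proof -
  define Q where "Q = q powi m"
  have Q: "Q \<noteq> 0" using q_nz by (simp add: Q_def)
  have Pa: "thprod (a * Q) = (-1) powi m * a powi (-m) * q powi (- tri m) * thprod a"
    and Pb: "thprod (b * Q) = (-1) powi m * b powi (-m) * q powi (- tri m) * thprod b"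
    unfolding Q_def by (simp_all add: thprod_shift nz)
  have "x * Q / (a * Q * (b * Q)) = x / (a * b) * q powi (- m)"
    unfolding power_int_minus_divide Q_def[symmetric] using Q nz by (simp add: field_simps)
  then have Pab: "thprod (x * Q / (a * Q * (b * Q)))
      = (-1) powi (-m) * (x / (a * b)) powi m * q powi (- tri (-m)) * thprod (x / (a * b))"
    using thprod_shift[of "x / (a * b)" "-m"] nz by simp
  have main: "Dser c (x * Q) (a * Q) * thprod (x * Q / (b * Q)) - Dser c (x * Q) (b * Q) * thprod (x * Q / (a * Q))
    = qinf c * qinf q * phi11 (q / c) q (c * (x * Q))
      * (a * Q * thprod (b * Q / (a * Q)) * thprod (x * Q / (a * Q * (b * Q))) / (thprod (a * Q) * thprod (b * Q)))"
    by (rule Dser_difference) (use nz Q P q_nz in \<open>simp_all add: Pa Pb\<close>)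
  have factor: "a * Q * thprod (b * Q / (a * Q)) * thprod (x * Q / (a * Q * (b * Q))) / (thprod (a * Q) * thprod (b * Q))
    = ((-1) powi m * x powi m * q powi tri m) * (a * thprod (b / a) * thprod (x / (a * b)) / (thprod a * thprod b))"
  proof -
    have s: "(-1 :: complex) powi (-m) = (-1) powi m"
      by (metis add.inverse_inverse inverse_minus_eq inverse_1 power_int_inverse power_int_minus)
    \<comment> \<open>The numerator contributes the exponent \<open>- tri m\<close>, the two
      denominators \<open>- 2 * tri m\<close>; the quotient therefore carries
      \<open>q powi tri m\<close>.\<close>
    have e: "m + - tri (- m) = tri m + (- tri m) + (- tri m)"
      by (simp add: tri_uminus)
    have e': "Q * q powi (- tri (-m)) = q powi tri m * q powi (- tri m) * q powi (- tri m)"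
      unfolding Q_def using q_nz e by (metis power_int_add)
    have "a * Q * thprod (b * Q / (a * Q)) * thprod (x * Q / (a * Q * (b * Q))) / (thprod (a * Q) * thprod (b * Q))
      = (a * thprod (b / a)) * ((-1) powi m * (x / (a * b)) powi m * (Q * q powi (- tri (-m))) * thprod (x / (a * b)))
       / (((-1) powi m * (-1) powi m) * (a powi (-m) * b powi (-m)) * (q powi (- tri m) * q powi (- tri m)) * (thprod a * thprod b))"
      unfolding Pa Pb Pab s using Q by (simp add: mult_ac)
    also have "\<dots> = ((-1) powi m * x powi m * q powi tri m) * (a * thprod (b / a) * thprod (x / (a * b)) / (thprod a * thprod b))"
      unfolding e' using nz q_nz P
      by (simp add: power_int_minus power_int_divide_distrib power_int_mult_distrib) (simp add: field_simps)
    finally show ?thesis .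
  qed
  have "x * Q / (b * Q) = x / b" "x * Q / (a * Q) = x / a"
    using Q by simp_all
  then show ?thesis
    using main unfolding factor by (simp only: Q_def mult.assoc)
qed

text \<open>The values tend to 1 as \<open>m\<close> increases, and each step downwards multiplies
  by a bounded factor. The growth is thus at most exponential, which the Gaussian factors of
  \<open>mu_hat\<close> absorb.\<close>

lemma qratio_growth:
  assumes a: "a \<noteq> 0" "\<And>n::int. a * q powi n \<noteq> 1"
  obtains K R where "K \<ge> 0" "R \<ge> 1" "\<And>m. norm (qratio c (a * q powi m)) \<le> K * R ^ nat \<bar>m\<bar>"
proof -
  have lim: "(\<lambda>n. d * q ^ n) \<longlonglongrightarrow> 0" for d
    by (rule tendsto_mult_right_zero, rule q_power_tendsto_0)
  have "(\<lambda>n. qratio c (a * q ^ n)) \<longlonglongrightarrow> 1 / 1"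
    unfolding qratio_def mult.assoc[symmetric]
    by (intro tendsto_divide qinf_tendsto_1 lim) auto
  then have "Bseq (\<lambda>n. qratio c (a * q ^ n))"
    by (rule convergent_imp_Bseq[OF convergentI])
  then obtain K where K: "K > 0" "\<And>n. norm (qratio c (a * q ^ n)) \<le> K"
    by (auto elim: BseqE)
  \<comment> \<open>This is (1 - c y) / (1 - y) at y = a / q^(k+1), multiplied through by the power
    of \<open>q\<close>; in this form it visibly converges, to \<open>c\<close>.\<close>
  define r where "r = (\<lambda>k. (q ^ Suc k - c * a) / (q ^ Suc k - a))"
  have "r \<longlonglongrightarrow> (q * 0 - c * a) / (q * 0 - a)"
    unfolding r_def power_Suc using a by (intro tendsto_intros q_power_tendsto_0) auto
  then have "Bseq r"
    by (rule convergent_imp_Bseq[OF convergentI])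
  then obtain R where R: "R > 0" "\<And>n. norm (r n) \<le> R"
    by (auto elim: BseqE)
  have step: "qratio c (a * q powi (- int (Suc k))) = r k * qratio c (a * q powi (- int k))" for k
  proof -
    define y where "y = a * q powi (- int (Suc k))"
    have yq: "y * q = a * q powi (- int k)"
      unfolding y_def power_int_neg_Suc using q_nz by (simp add: power_int_minus field_simps)
    have "y \<noteq> 1" unfolding y_def by (rule a)
    have "qratio c y = (1 - c * y) / (1 - y) * qratio c (y * q)"
      using qinf_step[of "c * y"] qinf_step[of y] by (simp add: qratio_def mult.assoc)
    also have "(1 - c * y) / (1 - y) = r k"
    proof -
      have "y = a / q ^ Suc k" unfolding y_def power_int_neg_Suc by simp
      then have "a = y * q ^ Suc k" using q_nz by simp
      then have "r k = (q ^ Suc k * (1 - c * y)) / (q ^ Suc k * (1 - y))"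
        by (simp add: r_def algebra_simps)
      then show ?thesis
        using q_nz by simp
    qed
    finally show ?thesis unfolding yq unfolding y_def .
  qed
  have neg: "norm (qratio c (a * q powi (- int k))) \<le> K * R ^ k" for k
  proof (induction k)
    case 0
    then show ?case using K(2)[of 0] by simp
  next
    case (Suc k)
    have "norm (r k) * norm (qratio c (a * q powi (- int k))) \<le> R * (K * R ^ k)"
      using R Suc by (intro mult_mono) (auto intro: less_imp_le)
    then show ?case
      unfolding step norm_mult by (simp add: mult_ac)
  qed
  show ?thesis
  \<comment> \<open>A base of at least 1 is required so that exponents can be enlarged when the
    bound is applied to a sum of indices.\<close>
  proof (rule that[of K "max R 1"])
    fix m :: int
    show "norm (qratio c (a * q powi m)) \<le> K * max R 1 ^ nat \<bar>m\<bar>"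
    proof (cases "m \<ge> 0")
      case True
      then obtain n where "m = int n" by (metis nonneg_int_cases)
      moreover have "K * 1 \<le> K * max R 1 ^ n"
        using K(1) by (intro mult_left_mono one_le_power) auto
      ultimately show ?thesis using K(2)[of n] by simp
    next
      case False
      then obtain k where m: "m = - int k" by (metis int_cases2 of_nat_0_le_iff)
      have "K * R ^ k \<le> K * max R 1 ^ k"
        using K(1) R(1) by (intro mult_left_mono power_mono) auto
      then show ?thesis using neg[of k] m by simp
    qed
  qed (use K R in auto)
qed

end

subsection \<open>Reduction to one dimension\<close>

definition ee :: "complex \<Rightarrow> complex" where
  "ee v = exp (2 * pi * \<i> * v)"

lemma ee_nz [simp]: "ee v \<noteq> 0"
  by (simp add: ee_def)

lemma ee_add: "ee (v + w) = ee v * ee w"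
  by (simp add: ee_def exp_add distrib_left)

lemma ee_diff: "ee (v - w) = ee v / ee w"
  by (simp add: ee_def exp_diff right_diff_distrib)

lemma ee_uminus: "ee (- v) = 1 / ee v"
  by (simp add: ee_def exp_minus inverse_eq_divide)

lemma ee_power_int: "ee v powi n = ee (of_int n * v)"
  by (simp add: ee_def exp_power_int mult_ac)

lemma ee_eq_1_iff: "ee v = 1 \<longleftrightarrow> (\<exists>m::int. v = of_int m)"
proof
  assume "ee v = 1"
  then obtain m :: int where "Im v = 0" "2 * pi * Re v = of_int (2 * m) * pi"
    unfolding ee_def exp_eq_1 by auto
  then have "v = of_int m" by (simp add: complex_eq_iff)
  then show "\<exists>m::int. v = of_int m" ..
next
  assume "\<exists>m::int. v = of_int m"
  then obtain m :: int where m: "v = of_int m" by auto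
  have "ee 1 = 1"
    unfolding ee_def using exp_two_pi_i' by (simp add: mult_ac)
  then show "ee v = 1"
    using ee_power_int[of 1 m] m by simp
qed

locale upper_half_plane =
  fixes \<tau> :: complex
  assumes Im_tau: "Im \<tau> > 0"
begin

sublocale nome_base "nome \<tau>"
  by unfold_locales (use Im_tau in \<open>auto simp: nome_def\<close>)

abbreviation q :: complex where "q \<equiv> nome \<tau>"

lemma q_eq: "q = ee \<tau>"
  by (simp add: nome_def ee_def)

lemma qpow_eq: "qpow \<tau> \<beta> = ee (\<beta> * \<tau>)"
  by (simp add: qpow_def ee_def mult_ac)

lemma qpow_of_int: "qpow \<tau> (of_int n) = q powi n"
  by (simp add: q_eq qpow_eq ee_power_int)

text \<open>The product is e(v + n \<tau>), which is 1 only if v + n \<tau> is an integer. So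
  avoiding the lattice means avoiding the poles of \<open>qratio\<close> and the zeros of
  \<open>thprod\<close>.\<close>

lemma not_lattice:
  assumes "v \<notin> lattice \<tau>"
  shows "ee v * q powi n \<noteq> 1"
proof
  assume "ee v * q powi n = 1"
  then have "ee (v + of_int n * \<tau>) = 1"
    by (simp add: q_eq ee_power_int ee_add)
  then obtain m :: int where "v + of_int n * \<tau> = of_int m"
    by (auto simp: ee_eq_1_iff)
  then have "v = of_int m + of_int (- n) * \<tau>" by (simp add: algebra_simps)
  then show False using assms unfolding lattice_def by blast
qed

lemma thprod_ee_nz: "v \<notin> lattice \<tau> \<Longrightarrow> thprod (ee v) \<noteq> 0"
  by (rule thprod_nz) (use not_lattice in auto)

definition theta_const :: complex where
  "theta_const = - \<i> * qpow \<tau> (1/8) * qinf q"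

lemma theta_const_nz [simp]: "theta_const \<noteq> 0"
  by (simp add: theta_const_def qpow_def)

lemma jtheta_eq: "jtheta v \<tau> = theta_const * exp (- pi * \<i> * v) * thprod (ee v)"
proof -
  have "q * exp (- 2 * pi * \<i> * v) = q / ee v"
    using ee_uminus[of v] by (simp add: ee_def exp_minus inverse_eq_divide)
  then show ?thesis
    unfolding jtheta_def thprod_def theta_const_def by (simp add: ee_def mult_ac)
qed



section \<open>The multivariable series in multiplicative variables\<close>

definition mu_factor :: "complex \<Rightarrow> int \<Rightarrow> complex" where
  "mu_factor v n = (-1) powi n * (1 / ee v) powi n * q powi (tri n + n) / jtheta v \<tau>"

lemma of_int_tri: "of_int (tri n + n) = (of_int n * (of_int n + 1) / 2 :: complex)"
proof -
  have "2 * of_int (tri n + n) = (of_int (2 * tri n + 2 * n) :: complex)" by simp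
  also have "\<dots> = of_int n * (of_int n + 1)"
    by (simp only: two_tri) (simp add: algebra_simps)
  finally show ?thesis by (metis nonzero_mult_div_cancel_left zero_neq_numeral)
qed

lemma mu_factor_eq:
  "(-1) powi n * exp (- 2 * pi * \<i> * of_int n * v) * qpow \<tau> (of_int n * (of_int n + 1) / 2) / jtheta v \<tau> = mu_factor v n"
proof -
  have "exp (- 2 * pi * \<i> * of_int n * v) = (1 / ee v) powi n"
    unfolding ee_uminus[symmetric] ee_power_int by (simp add: ee_def mult_ac)
  moreover have "qpow \<tau> (of_int n * (of_int n + 1) / 2) = q powi (tri n + n)"
    unfolding of_int_tri[symmetric] by (rule qpow_of_int)
  ultimately show ?thesis by (simp add: mu_factor_def)
qed

lemma mu_hat_eq:
  "mu_hat N u \<alpha> \<tau> = exp (pi * \<i> * (\<alpha> - 1) * (\<Sum>j\<le>N. u j)) *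
     (\<Sum>\<^sub>\<infinity> ns \<in> {ns. length ns = N}. exp (pi * \<i> * u 0) * qratio (qpow \<tau> \<alpha>) (ee (u 0) * q powi (sum_list ns))
        * (\<Prod>j<N. mu_factor (u (Suc j)) (ns ! j)))"
proof -
  have "exp (2 * pi * \<i> * u 0) * qpow \<tau> (\<alpha> + of_int m) = qpow \<tau> \<alpha> * (ee (u 0) * q powi m)" for m
    unfolding qpow_of_int[symmetric] qpow_eq distrib_right ee_add by (simp add: ee_def)
  moreover have "exp (2 * pi * \<i> * u 0) * qpow \<tau> (of_int m) = ee (u 0) * q powi m" for m
    by (simp add: qpow_of_int ee_def)
  ultimately show ?thesis
    unfolding mu_hat_def mu_factor_eq qratio_def by (simp add: mult.assoc)
qed

text \<open>The bound \<open>R ^ nat \<bar>sum_list ns\<bar>\<close> is at most the product of the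
  corresponding powers for the single entries, so the majorant splits into one-index Gaussian
  series.\<close>

lemma mu_hat_summable:
  assumes u: "u 0 \<notin> lattice \<tau>"
  shows "(\<lambda>ns. exp (pi * \<i> * u 0) * qratio c (ee (u 0) * q powi (sum_list ns))
    * (\<Prod>j<N. mu_factor (u (Suc j)) (ns ! j))) summable_on {ns. length ns = N}"
proof -
  obtain K R where K: "K \<ge> 0" and R: "R \<ge> 1"
    and bound: "\<And>m. norm (qratio c (ee (u 0) * q powi m)) \<le> K * R ^ nat \<bar>m\<bar>"
    using qratio_growth[of "ee (u 0)" c] not_lattice[OF u] by auto
  define g where "g = (\<lambda>j n. R ^ nat \<bar>n\<bar> * norm (mu_factor (u (Suc j)) n))"
  have g: "g j summable_on UNIV" for j
  proof -
    define v where "v = u (Suc j)"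
    have "(\<lambda>n. norm q powi tri n * norm (q / ee v) powi n * R ^ nat \<bar>n\<bar> * (1 / norm (jtheta v \<tau>))) summable_on UNIV"
      using q_nz q_lt_1 R by (intro summable_on_cmult_left summable_on_gauss_abs) auto
    moreover have "norm q powi tri n * norm (q / ee v) powi n * R ^ nat \<bar>n\<bar> * (1 / norm (jtheta v \<tau>)) = g j n" for n
      unfolding g_def mu_factor_def v_def[symmetric] using q_nz
      by (simp add: norm_mult norm_divide norm_power_int power_int_add power_int_divide_distrib)
    ultimately show ?thesis by simp
  qed
  have g0: "g j n \<ge> 0" for j n
    using R by (simp add: g_def)
  define A where "A = norm (exp (pi * \<i> * u 0)) * K"
  have "(\<lambda>ns. A * (\<Prod>j<N. g j (ns ! j))) summable_on {ns. length ns = N}"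
    by (intro summable_on_cmult_right summable_on_lists g g0)
  moreover have "norm (exp (pi * \<i> * u 0) * qratio c (ee (u 0) * q powi (sum_list ns))
    * (\<Prod>j<N. mu_factor (u (Suc j)) (ns ! j))) \<le> A * (\<Prod>j<N. g j (ns ! j))" if "length ns = N" for ns
  proof -
    have "nat \<bar>sum_list ns\<bar> \<le> (\<Sum>j<N. nat \<bar>ns ! j\<bar>)"
    proof -
      have "\<bar>sum_list ns\<bar> \<le> (\<Sum>j<N. \<bar>ns ! j\<bar>)"
        unfolding sum_list_eq_sum[OF that] by (rule sum_abs)
      also have "\<dots> = int (\<Sum>j<N. nat \<bar>ns ! j\<bar>)" by simp
      finally show ?thesis by linarith
    qed
    then have "R ^ nat \<bar>sum_list ns\<bar> \<le> (\<Prod>j<N. R ^ nat \<bar>ns ! j\<bar>)"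
      unfolding power_sum[symmetric] using R by (rule power_increasing)
    then have "norm (qratio c (ee (u 0) * q powi (sum_list ns))) \<le> K * (\<Prod>j<N. R ^ nat \<bar>ns ! j\<bar>)"
      using bound[of "sum_list ns"] K by (meson mult_left_mono order_trans)
    then have "norm (exp (pi * \<i> * u 0)) * norm (qratio c (ee (u 0) * q powi (sum_list ns)))
        * norm (\<Prod>j<N. mu_factor (u (Suc j)) (ns ! j))
      \<le> norm (exp (pi * \<i> * u 0)) * (K * (\<Prod>j<N. R ^ nat \<bar>ns ! j\<bar>)) * norm (\<Prod>j<N. mu_factor (u (Suc j)) (ns ! j))"
      by (intro mult_right_mono mult_left_mono) auto
    also have "\<dots> = A * (\<Prod>j<N. g j (ns ! j))"
      by (simp add: A_def g_def prod.distrib prod_norm mult_ac)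
    finally show ?thesis by (simp only: norm_mult)
  qed
  ultimately have "(\<lambda>ns. norm (exp (pi * \<i> * u 0) * qratio c (ee (u 0) * q powi (sum_list ns))
    * (\<Prod>j<N. mu_factor (u (Suc j)) (ns ! j)))) summable_on {ns. length ns = N}"
    by (rule summable_on_comparison_test) auto
  then show ?thesis by (rule abs_summable_summable)
qed

text \<open>Fubini with the head of the list as inner index. The remaining entries enter the inner
  sum only through their total, which multiplies both arguments of \<open>Dser\<close> by a power of
  \<open>q\<close>.\<close>

lemma mu_hat_Suc_has_sum:
  assumes u: "u 0 \<notin> lattice \<tau>"
  shows "((\<lambda>r. exp (pi * \<i> * (\<alpha> - 1) * (\<Sum>j\<le>Suc k. u j)) *
      (exp (pi * \<i> * u 0) / jtheta (u 1) \<tau>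
        * Dser (qpow \<tau> \<alpha>) (ee (u 0 + u 1) * q powi (sum_list r)) (ee (u 0) * q powi (sum_list r))
        * (\<Prod>j<k. mu_factor (u (Suc (Suc j))) (r ! j))))
      has_sum mu_hat (Suc k) u \<alpha> \<tau>) {r. length r = k}"
proof -
  define c where "c = qpow \<tau> \<alpha>"
  define F where "F = (\<lambda>ns. exp (pi * \<i> * u 0) * qratio c (ee (u 0) * q powi (sum_list ns))
    * (\<Prod>j<Suc k. mu_factor (u (Suc j)) (ns ! j)))"
  define W where "W = (\<lambda>r. \<Prod>j<k. mu_factor (u (Suc (Suc j))) (r ! j))"
  define G where "G = (\<lambda>r. exp (pi * \<i> * u 0) / jtheta (u 1) \<tau>
        * Dser c (ee (u 0 + u 1) * q powi (sum_list r)) (ee (u 0) * q powi (sum_list r)) * W r)"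
  have F: "F summable_on {ns. length ns = Suc k}"
    unfolding F_def by (rule mu_hat_summable[where u = u, OF u])
  then have "(\<lambda>z. F ((\<lambda>(n, r). n # r) z)) summable_on (UNIV \<times> {r. length r = k})"
    using summable_on_reindex_bij_betw[OF bij_betw_Cons] by blast
  then have "(\<lambda>(n, r). F (n # r)) summable_on (UNIV \<times> {r. length r = k})"
    by (simp add: case_prod_unfold)
  then have s: "(\<lambda>(r, n). F (n # r)) summable_on ({r. length r = k} \<times> UNIV)"
    by (subst summable_on_swap) (simp add: case_prod_unfold)
  have inner: "(\<Sum>\<^sub>\<infinity>n. F (n # r)) = G r" for r
  proof -
    define m where "m = sum_list r"
    have "F (n # r) = exp (pi * \<i> * u 0) / jtheta (u 1) \<tau> * W r *
        (qratio c (ee (u 0) * q powi m * q powi n)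
          * ((-1) powi n * ((ee (u 0) * q powi m) / (ee (u 0 + u 1) * q powi m)) powi n * q powi (tri n + n)))" for n
    proof -
      have 1: "(ee (u 0) * q powi m) / (ee (u 0 + u 1) * q powi m) = 1 / ee (u 1)"
        using q_nz by (simp add: ee_add)
      have 2: "ee (u 0) * q powi (n + m) = ee (u 0) * q powi m * q powi n"
        using q_nz by (simp add: power_int_add)
      show ?thesis
        unfolding F_def prod_nth_Cons[where f = "\<lambda>j. mu_factor (u (Suc j))"] 1
        by (simp add: mu_factor_def[of "u (Suc 0)" n] W_def 2 mult_ac flip: m_def)
    qed
    then have "(\<Sum>\<^sub>\<infinity>n. F (n # r)) = exp (pi * \<i> * u 0) / jtheta (u 1) \<tau> * W r
        * Dser c (ee (u 0 + u 1) * q powi m) (ee (u 0) * q powi m)"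
      unfolding Dser_def by (simp only: infsum_cmult_right')
    then show ?thesis by (simp add: G_def m_def mult_ac)
  qed
  have "infsum F {ns. length ns = Suc k} = infsum (\<lambda>z. F ((\<lambda>(n, r). n # r) z)) (UNIV \<times> {r. length r = k})"
    by (rule infsum_reindex_bij_betw[OF bij_betw_Cons, symmetric])
  also have "\<dots> = (\<Sum>\<^sub>\<infinity>n. \<Sum>\<^sub>\<infinity>r\<in>{r. length r = k}. F (n # r))"
    using infsum_Sigma'_banach[OF \<open>(\<lambda>(n, r). F (n # r)) summable_on (UNIV \<times> {r. length r = k})\<close>]
    by (simp add: case_prod_unfold)
  also have "\<dots> = infsum G {r. length r = k}"
    using infsum_swap_banach[OF s] by (simp add: inner)
  finally have "infsum F {ns. length ns = Suc k} = infsum G {r. length r = k}" .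
  moreover have "G summable_on {r. length r = k}"
    using summable_on_Sigma_banach[OF s] by (simp add: inner)
  ultimately have "(G has_sum infsum F {ns. length ns = Suc k}) {r. length r = k}"
    by (simp add: has_sum_iff)
  then show ?thesis
    unfolding mu_hat_eq G_def F_def W_def c_def by (rule has_sum_cmult_right)
qed

text \<open>Here the factor produced by \<open>Dser_difference_shifted\<close> meets the remaining
  \<open>mu_factor\<close> terms. With m the sum of the entries, the signs cancel, and so do the
  linear parts -m/2 and m/2 of the exponents of \<open>q\<close>, leaving half the form of
  \<open>Shat\<close>.\<close>

lemma quadratic_factor:
  assumes r: "length r = k"
  shows "(-1) powi sum_list r * ee s powi sum_list r * q powi tri (sum_list r) * (\<Prod>j<k. mu_factor (v j) (r ! j))
    = qpow \<tau> (of_int (\<Sum>j<k. \<Sum>l<k. Shat j l * (r ! j) * (r ! l)) / 2)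
      * (\<Prod>j<k. exp (2 * pi * \<i> * of_int (r ! j) * (s - v j))) / (\<Prod>j<k. jtheta (v j) \<tau>)"
proof -
  define m where "m = sum_list r"
  have m: "m = (\<Sum>j<k. r ! j)"
    unfolding m_def by (rule sum_list_eq_sum[OF r])
  define Q where "Q = tri m + (\<Sum>j<k. tri (r ! j) + r ! j)"
  have "(\<Sum>j<k. \<Sum>l<k. Shat j l * (r ! j) * (r ! l)) = 2 * Q"
  proof -
    have "2 * Q = m * (m - 1) + (\<Sum>j<k. 2 * tri (r ! j) + 2 * r ! j)"
      by (simp add: Q_def two_tri sum_distrib_left distrib_left)
    also have "(\<Sum>j<k. 2 * tri (r ! j) + 2 * r ! j) = (\<Sum>j<k. r ! j * r ! j) + m"
      unfolding m sum.distrib[symmetric] by (rule sum.cong) (simp_all only: two_tri, simp add: algebra_simps)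
    finally show ?thesis
      unfolding Shat_quadratic_form m[symmetric] by (simp add: algebra_simps)
  qed
  then have 1: "qpow \<tau> (of_int (\<Sum>j<k. \<Sum>l<k. Shat j l * (r ! j) * (r ! l)) / 2) = q powi Q"
    using qpow_of_int[of Q] by simp
  have "exp (2 * pi * \<i> * of_int (r ! j) * (s - v j)) = ee s powi (r ! j) * (1 / ee (v j)) powi (r ! j)" for j
    unfolding ee_uminus[symmetric] ee_power_int ee_add[symmetric] by (simp add: ee_def algebra_simps)
  then have 2: "(\<Prod>j<k. exp (2 * pi * \<i> * of_int (r ! j) * (s - v j))) = ee s powi m * (\<Prod>j<k. (1 / ee (v j)) powi (r ! j))"
    by (simp only: prod.distrib m) (simp add: prod_power_int)
  have 3: "(\<Prod>j<k. mu_factor (v j) (r ! j)) = (-1) powi m * (\<Prod>j<k. (1 / ee (v j)) powi (r ! j))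
      * q powi (\<Sum>j<k. tri (r ! j) + r ! j) / (\<Prod>j<k. jtheta (v j) \<tau>)"
    unfolding mu_factor_def prod_dividef prod.distrib m using q_nz by (simp only: prod_power_int neg_equal_0_iff_equal one_neq_zero simp_thms)
  have 4: "q powi Q = q powi tri m * q powi (\<Sum>j<k. tri (r ! j) + r ! j)"
    unfolding Q_def using q_nz by (simp only: power_int_add simp_thms)
  have "(-1) powi m * ee s powi m * q powi tri m * (\<Prod>j<k. mu_factor (v j) (r ! j))
    = ((-1) powi m * (-1) powi m) * ee s powi m * (q powi tri m * q powi (\<Sum>j<k. tri (r ! j) + r ! j))
      * (\<Prod>j<k. (1 / ee (v j)) powi (r ! j)) / (\<Prod>j<k. jtheta (v j) \<tau>)"
    unfolding 3 by simp
  then show ?thesis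
    unfolding 1 2 m_def[symmetric] 4 by simp
qed

text \<open>\<open>Dser_difference_shifted\<close> in additive variables. Up to elementary factors
  \<open>jtheta (\<alpha> * \<tau>) \<tau>\<close> is \<open>qinf c * qinf (q / c)\<close>, and
  dividing by the nonzero \<open>qinf (q / c)\<close> yields the required
  \<open>qinf c\<close>.\<close>

lemma theta_difference:
  assumes l: "u0 \<notin> lattice \<tau>" "u1 \<notin> lattice \<tau>" "z - u0 \<notin> lattice \<tau>" "z + u1 \<notin> lattice \<tau>"
    and nz: "qinf (qpow \<tau> (1 - \<alpha>)) \<noteq> 0"
  defines "c \<equiv> qpow \<tau> \<alpha>" and "x \<equiv> ee (u0 + u1)"
  shows "exp (pi * \<i> * u0) / jtheta u1 \<tau> * Dser c (x * q powi m) (ee u0 * q powi m)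
    - exp (pi * \<i> * (u0 - z)) / jtheta (u1 + z) \<tau> * Dser c (x * q powi m) (ee (u0 - z) * q powi m)
    = exp (pi * \<i> * \<alpha> * \<tau>) * jtheta (\<alpha> * \<tau>) \<tau> * jtheta z \<tau> * jtheta (z - u0 + u1) \<tau> * qinf q
      / (jtheta (z - u0) \<tau> * jtheta (z + u1) \<tau> * jtheta u0 \<tau> * jtheta u1 \<tau> * qinf (qpow \<tau> (1 - \<alpha>)))
      * (phi11 (qpow \<tau> (1 - \<alpha>)) q (ee (u0 + u1 + \<alpha> * \<tau>) * q powi m)
         * ((-1) powi m * x powi m * q powi tri m))"
proof -
  define a where "a = ee u0"
  define b where "b = ee (u0 - z)"
  define e0 where "e0 = exp (- pi * \<i> * u0)"
  define e1 where "e1 = exp (- pi * \<i> * u1)"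
  define ez where "ez = exp (- pi * \<i> * z)"
  have e: "e0 \<noteq> 0" "e1 \<noteq> 0" "ez \<noteq> 0" by (simp_all add: e0_def e1_def ez_def)
  have abcx: "a \<noteq> 0" "b \<noteq> 0" "c \<noteq> 0" "x \<noteq> 0"
    by (simp_all add: a_def b_def c_def x_def qpow_eq)
  have qc: "qpow \<tau> (1 - \<alpha>) = q / c"
    by (simp add: c_def qpow_eq q_eq left_diff_distrib ee_diff)
  have Pb': "thprod (1 / b) \<noteq> 0"
    using thprod_ee_nz[OF l(3)] by (simp add: b_def ee_diff)
  then have Pb: "thprod b \<noteq> 0"
    using thprod_inverse[of b] abcx by auto
  have Pa: "thprod a \<noteq> 0" unfolding a_def by (rule thprod_ee_nz) (rule l)
  have xa: "ee u1 = x / a" by (simp add: x_def a_def ee_add)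
  have xb: "ee (u1 + z) = x / b" by (simp add: x_def b_def ee_add ee_diff field_simps)
  have Pxa: "thprod (x / a) \<noteq> 0" unfolding xa[symmetric] by (rule thprod_ee_nz) (rule l)
  have Pxb: "thprod (x / b) \<noteq> 0" unfolding xb[symmetric] by (rule thprod_ee_nz) (use l in \<open>simp add: add.commute\<close>)
  have t0: "jtheta u0 \<tau> = theta_const * e0 * thprod a"
    by (simp add: jtheta_eq e0_def a_def)
  have t1: "jtheta u1 \<tau> = theta_const * e1 * thprod (x / a)"
    unfolding jtheta_eq xa e1_def ..
  have tz1: "jtheta (u1 + z) \<tau> = theta_const * (e1 * ez) * thprod (x / b)"
    unfolding jtheta_eq xb e1_def ez_def by (simp add: distrib_left exp_add exp_diff exp_minus field_simps)
  \<comment> \<open>\<open>ee z\<close> is \<open>a / b\<close> and \<open>ee (z - u0)\<close> is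
    \<open>1 / b\<close>, the inverses of the arguments in \<open>Dser_difference\<close>. Both are
    reflected, and the two signs cancel in the quotient.\<close>
  have tz: "jtheta z \<tau> = theta_const * ez * (- thprod (b / a) * a / b)"
  proof -
    have "ee z = 1 / (b / a)" by (simp add: a_def b_def ee_diff)
    then show ?thesis
      unfolding jtheta_eq ez_def using thprod_inverse[of "b / a"] abcx by simp
  qed
  have tzu: "jtheta (z - u0) \<tau> = theta_const * (ez / e0) * (- thprod b / b)"
  proof -
    have "ee (z - u0) = 1 / b" by (simp add: b_def ee_diff)
    moreover have "exp (- pi * \<i> * (z - u0)) = ez / e0"
      by (simp add: ez_def e0_def right_diff_distrib exp_diff exp_minus field_simps)
    ultimately show ?thesis
      using thprod_inverse[of b] abcx by (simp add: jtheta_eq)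
  qed
  have tzuu: "jtheta (z - u0 + u1) \<tau> = theta_const * (ez / e0 * e1) * thprod (x / (a * b))"
  proof -
    have "ee (z - u0 + u1) = x / (a * b)" by (simp add: a_def b_def x_def ee_diff ee_add)
    then show ?thesis
      unfolding jtheta_eq ez_def e0_def e1_def
      by (simp add: right_diff_distrib distrib_left exp_add exp_diff exp_minus field_simps)
  qed
  have ta: "exp (pi * \<i> * \<alpha> * \<tau>) * jtheta (\<alpha> * \<tau>) \<tau> = theta_const * (qinf c * qinf (q / c))"
    by (simp add: jtheta_eq c_def qpow_eq thprod_def exp_minus field_simps)
  have x0: "exp (pi * \<i> * u0) = 1 / e0"
    by (simp add: e0_def exp_minus field_simps)
  have xz: "exp (pi * \<i> * (u0 - z)) = ez / e0"
    by (simp add: e0_def ez_def exp_minus exp_diff right_diff_distrib field_simps)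
  have ph: "ee (u0 + u1 + \<alpha> * \<tau>) * q powi m = c * x * q powi m"
    by (simp add: c_def x_def qpow_eq ee_add)
  define Da where "Da = Dser c (x * q powi m) (a * q powi m)"
  define Db where "Db = Dser c (x * q powi m) (b * q powi m)"
  define p where "p = phi11 (q / c) q (c * x * q powi m)"
  define M where "M = (-1) powi m * x powi m * q powi tri m"
  have main: "Da * thprod (x / b) - Db * thprod (x / a) = qinf c * qinf q * p * M
      * (a * thprod (b / a) * thprod (x / (a * b)) / (thprod a * thprod b))"
    unfolding Da_def Db_def p_def M_def by (rule Dser_difference_shifted) (use abcx Pa Pb in auto)
  have "1 / e0 / (theta_const * e1 * thprod (x / a)) * Da - ez / e0 / (theta_const * (e1 * ez) * thprod (x / b)) * Db
    = (Da * thprod (x / b) - Db * thprod (x / a)) / (theta_const * e0 * e1 * thprod (x / a) * thprod (x / b))"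
    using e Pxa Pxb by (simp add: field_simps)
  also have "\<dots> = theta_const * (qinf c * qinf (q / c)) * (theta_const * ez * (- thprod (b / a) * a / b))
        * (theta_const * (ez / e0 * e1) * thprod (x / (a * b))) * qinf q
      / (theta_const * (ez / e0) * (- thprod b / b) * (theta_const * (e1 * ez) * thprod (x / b)) * (theta_const * e0 * thprod a)
        * (theta_const * e1 * thprod (x / a)) * qinf (q / c)) * (p * M)"
    unfolding main using e Pxa Pxb Pa Pb nz[unfolded qc] abcx by (simp add: field_simps)
  finally show ?thesis
    unfolding ta ph qc t0 t1 tz1 add.commute[of z u1] tz tzu tzuu x0 xz a_def[symmetric] b_def[symmetric]
      Da_def Db_def p_def M_def .
qed

end

section \<open>Summation over the remaining indices\<close>

theorem theorem1p1:
  fixes N :: nat and \<alpha> \<tau> z :: complex and u :: "nat \<Rightarrow> complex"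
  assumes "Im \<tau> > 0"
    and "N \<ge> 1"
    and "qpoch_inf (qpow \<tau> (1 - \<alpha>)) (nome \<tau>) \<noteq> 0"
    and "\<forall>j\<le>N. u j \<notin> lattice \<tau>"
    and "z - u 0 \<notin> lattice \<tau>"
    and "z + u 1 \<notin> lattice \<tau>"
  shows "mu_hat N u \<alpha> \<tau> - mu_hat N (u(0 := u 0 - z, 1 := u 1 + z)) \<alpha> \<tau> =
    exp (pi * \<i> * (\<alpha> - 1) * (\<Sum>j\<le>N. u j) + pi * \<i> * \<alpha> * \<tau>)
    * jtheta (\<alpha> * \<tau>) \<tau> * jtheta z \<tau> * jtheta (z - u 0 + u 1) \<tau> * qpoch_inf (nome \<tau>) (nome \<tau>)
    / (jtheta (z - u 0) \<tau> * jtheta (z + u 1) \<tau> * (\<Prod>j\<le>N. jtheta (u j) \<tau>)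
       * qpoch_inf (qpow \<tau> (1 - \<alpha>)) (nome \<tau>))
    * (\<Sum>\<^sub>\<infinity> ns \<in> {ns :: int list. length ns = N - 1}.
        qpow \<tau> (of_int (\<Sum>j<N - 1. \<Sum>k<N - 1. Shat j k * (ns ! j) * (ns ! k)) / 2)
        * (\<Prod>j<N - 1. exp (2 * pi * \<i> * of_int (ns ! j) * (u 0 + u 1 - u (j + 2))))
        * phi11 (qpow \<tau> (1 - \<alpha>)) (nome \<tau>)
            (exp (2 * pi * \<i> * (u 0 + u 1 + \<alpha> * \<tau>)) * qpow \<tau> (of_int (sum_list ns))))"
proof -
  interpret upper_half_plane \<tau> by unfold_locales fact
  \<comment> \<open>\<open>k\<close> is the number of indices left after the first; for
    \<open>k = 0\<close> the only list is \<open>[]\<close>.\<close>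
  obtain k where N: "N = Suc k" using assms(2) by (cases N) auto
  define u' where "u' = u(0 := u 0 - z, 1 := u 1 + z)"
  have sum_split: "(\<Sum>j\<le>Suc k. f j) = f 0 + (f 1 + (\<Sum>j<k. f (Suc (Suc j))))" for f :: "nat \<Rightarrow> complex"
    unfolding lessThan_Suc_atMost[symmetric] sum.lessThan_Suc_shift by simp
  have prod_split: "(\<Prod>j\<le>Suc k. f j) = f 0 * (f 1 * (\<Prod>j<k. f (Suc (Suc j))))" for f :: "nat \<Rightarrow> complex"
    unfolding lessThan_Suc_atMost[symmetric] prod.lessThan_Suc_shift by simp
  have u': "u' 0 = u 0 - z" "u' 1 = u 1 + z" "\<And>j. u' (Suc (Suc j)) = u (Suc (Suc j))"
    by (simp_all add: u'_def)
  \<comment> \<open>Moving z from u_0 to u_1 preserves the total of all arguments, hence the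
    exponential prefactor; \<open>s'\<close> below does the same for \<open>x\<close>.\<close>
  have sum_u': "(\<Sum>j\<le>Suc k. u' j) = (\<Sum>j\<le>Suc k. u j)"
    unfolding sum_split u' by simp
  have u0: "u 0 \<notin> lattice \<tau>" "u 1 \<notin> lattice \<tau>" using assms(4) N by auto
  have u'0: "u' 0 \<notin> lattice \<tau>"
  proof
    assume "u' 0 \<in> lattice \<tau>"
    then obtain m n :: int where "u 0 - z = of_int m + of_int n * \<tau>"
      by (auto simp: lattice_def u')
    then have "z - u 0 = of_int (- m) + of_int (- n) * \<tau>" by (simp add: algebra_simps)
    then show False using assms(5) unfolding lattice_def by blast
  qed
  have s': "u 0 - z + (u 1 + z) = u 0 + u 1" by simp
  define A where "A = exp (pi * \<i> * (\<alpha> - 1) * (\<Sum>j\<le>Suc k. u j))"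
  define V where "V = (\<lambda>r. \<Prod>j<k. mu_factor (u (Suc (Suc j))) (r ! j))"
  define B where "B = exp (pi * \<i> * \<alpha> * \<tau>) * jtheta (\<alpha> * \<tau>) \<tau> * jtheta z \<tau> * jtheta (z - u 0 + u 1) \<tau> * qinf q
      / (jtheta (z - u 0) \<tau> * jtheta (z + u 1) \<tau> * jtheta (u 0) \<tau> * jtheta (u 1) \<tau> * qinf (qpow \<tau> (1 - \<alpha>)))"
  define J where "J = (\<Prod>j<k. jtheta (u (Suc (Suc j))) \<tau>)"
  define p where "p = (\<lambda>r. phi11 (qpow \<tau> (1 - \<alpha>)) q (ee (u 0 + u 1 + \<alpha> * \<tau>) * q powi (sum_list r)))"
  define Y where "Y = (\<lambda>r. qpow \<tau> (of_int (\<Sum>j<k. \<Sum>l<k. Shat j l * (r ! j) * (r ! l)) / 2)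
      * (\<Prod>j<k. exp (2 * pi * \<i> * of_int (r ! j) * (u 0 + u 1 - u (Suc (Suc j))))))"
  define D where "D = (\<lambda>v r. Dser (qpow \<tau> \<alpha>) (ee (u 0 + u 1) * q powi (sum_list r)) (ee v * q powi (sum_list r)))"
  \<comment> \<open>Both series run over the same lists \<open>r\<close>, so they are subtracted
    termwise and \<open>theta_difference\<close> applies to each \<open>r\<close> with m =
    \<open>sum_list r\<close>.\<close>
  have "((\<lambda>r. A * (exp (pi * \<i> * u 0) / jtheta (u 1) \<tau> * D (u 0) r * V r)
      - A * (exp (pi * \<i> * (u 0 - z)) / jtheta (u 1 + z) \<tau> * D (u 0 - z) r * V r))
      has_sum (mu_hat (Suc k) u \<alpha> \<tau> - mu_hat (Suc k) u' \<alpha> \<tau>)) {r. length r = k}"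
    using has_sum_add[OF mu_hat_Suc_has_sum[where u = u, OF u0(1), of \<alpha> k]
        has_sum_uminusI[OF mu_hat_Suc_has_sum[where u = u', OF u'0, of \<alpha> k]]]
    unfolding sum_u' u' s' A_def D_def V_def by (simp only: diff_conv_add_uminus)
  moreover have "A * (exp (pi * \<i> * u 0) / jtheta (u 1) \<tau> * D (u 0) r * V r)
      - A * (exp (pi * \<i> * (u 0 - z)) / jtheta (u 1 + z) \<tau> * D (u 0 - z) r * V r)
      = A * B / J * (Y r * p r)" if "length r = k" for r
  proof -
    define m where "m = sum_list r"
    have "A * (exp (pi * \<i> * u 0) / jtheta (u 1) \<tau> * D (u 0) r * V r)
      - A * (exp (pi * \<i> * (u 0 - z)) / jtheta (u 1 + z) \<tau> * D (u 0 - z) r * V r)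
      = A * V r * (exp (pi * \<i> * u 0) / jtheta (u 1) \<tau> * D (u 0) r
         - exp (pi * \<i> * (u 0 - z)) / jtheta (u 1 + z) \<tau> * D (u 0 - z) r)"
      by (simp only: right_diff_distrib mult_ac)
    also have "\<dots> = A * V r * (B * (p r * ((-1) powi m * ee (u 0 + u 1) powi m * q powi tri m)))"
      unfolding D_def B_def p_def m_def by (subst theta_difference[OF u0 assms(5,6,3)]) simp
    also have "\<dots> = A * B * p r * ((-1) powi m * ee (u 0 + u 1) powi m * q powi tri m * V r)"
      by (simp only: mult_ac)
    also have "(-1) powi m * ee (u 0 + u 1) powi m * q powi tri m * V r = Y r / J"
      unfolding m_def V_def Y_def J_def by (rule quadratic_factor[OF that])
    finally show ?thesis by simp
  qed
  ultimately have "((\<lambda>r. A * B / J * (Y r * p r)) has_sum (mu_hat (Suc k) u \<alpha> \<tau> - mu_hat (Suc k) u' \<alpha> \<tau>)) {r. length r = k}"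
    by (subst (asm) has_sum_cong) auto
  then have "mu_hat (Suc k) u \<alpha> \<tau> - mu_hat (Suc k) u' \<alpha> \<tau> = A * B / J * (\<Sum>\<^sub>\<infinity>r\<in>{r. length r = k}. Y r * p r)"
    using infsumI infsum_cmult_right' by metis
  also have "A * B / J = exp (pi * \<i> * (\<alpha> - 1) * (\<Sum>j\<le>N. u j) + pi * \<i> * \<alpha> * \<tau>)
    * jtheta (\<alpha> * \<tau>) \<tau> * jtheta z \<tau> * jtheta (z - u 0 + u 1) \<tau> * qpoch_inf (nome \<tau>) (nome \<tau>)
    / (jtheta (z - u 0) \<tau> * jtheta (z + u 1) \<tau> * (\<Prod>j\<le>N. jtheta (u j) \<tau>)
       * qpoch_inf (qpow \<tau> (1 - \<alpha>)) (nome \<tau>))"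
    unfolding N prod_split A_def B_def J_def exp_add by (simp add: mult_ac)
  finally show ?thesis
    unfolding N u'_def Y_def p_def ee_def qpow_of_int by (simp only: add_2_eq_Suc' diff_Suc_1)
qed

end
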